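(* Let $w=(w(n))_{n\in\mathbb{N}}$ be a nonnegative weight sequence, let $\psi(n)=n/\phi_{\gamma_{1,w}}(n)$ for every $n\in\mathbb{N}$, and let $x\in S_{\gamma_{1,w}^*}$. Then $x$ is an extreme point of $B_{\gamma_{1,w}^*}$ if and only if $$x^*(n)=\sum_{i=n}^\infty\frac{w(i)}{i}\quad\text{for all } n\in\mathbb{N}.$$
   Context: $\mathbb{N}$ is the set of positive integers and $\ell^0$ is the set of all real sequences. For $x\in\ell^0$ put $d_x(\lambda)=\operatorname{card}\{k\in\mathbb{N}:|x(k)|>\lambda\}$ for $\lambda\ge 0$, $x^*(n)=\inf\{\lambda\ge 0: d_x(\lambda)\le n-1\}$ (decreasing rearrangement) and $x^{**}(n)=\frac1n\sum_{i=1}^n x^*(i)$ for $n\in\mathbb{N}$. A nonnegative weight sequence is a sequence $w=(w(n))_{n\in\mathbb{N}}$ of nonnegative reals, with $w(n)>0$ for at least one $n$, such that $W_1(n)=n\sum_{i=n+1}^\infty \frac{w(i)}{i}<\infty$ for every $n\in\mathbb{N}$. Put $W(n)=\sum_{i=1}^n w(i)$ and $W(\infty)=\sum_{i=1}^\infty w(i)$. The sequence Lorentz space $\gamma_{1,w}$ is the Banach space of all $x\in\ell^0$ with $\|x\|_{\gamma_{1,w}}=\sum_{n=1}^\infty x^{**}(n) w(n)<\infty$; its fundamental sequence is $\phi_{\gamma_{1,w}}(n)=\|\chi_{\{i\in\mathbb{N}:i\le n\}}\|_{\gamma_{1,w}}=W(n)+W_1(n)$, and $\gamma_{1,w}^*$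 is its dual space. Elements of $\gamma_{1,w}^*$ are regarded as sequences $y$ through the pairing $u\mapsto\sum_{n=1}^\infty u(n)y(n)$, $u\in\gamma_{1,w}$. (For reference: this pairing identifies $\gamma_{1,w}^*$ isometrically with the Marcinkiewicz space $m_\psi$ of all $y\in\ell^0$ with $\|y\|_{m_\psi}=\sup_{n\in\mathbb{N}} y^{**}(n)\psi(n)<\infty$ if and only if $W(\infty)=\infty$.) $S_X$ and $B_X$ denote the unit sphere and the closed unit ball of a Banach space $X$; $x\in S_X$ is an extreme point of $B_X$ if for any $y,z\in S_X$ with $x=(y+z)/2$ one has $x=y=z$. *)

theory Defs
  imports "HOL-Analysis.Analysis" "HOL-Library.Extended_Nat"
begin

(* Sequences are indexed by the positive integers.  They are encoded as functions on nat
   whose value at the junk index 0 is 0, so that equality of functions is equality of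
   sequences. *)
definition seqs :: "(nat \<Rightarrow> real) set" where
  "seqs = {x. x 0 = 0}"

(* card is 0 on infinite sets, so the distribution function takes values in enat. *)
definition distr_fun :: "(nat \<Rightarrow> real) \<Rightarrow> real \<Rightarrow> enat" where
  "distr_fun x l =
     (if finite {k. 1 \<le> k \<and> \<bar>x k\<bar> > l} then enat (card {k. 1 \<le> k \<and> \<bar>x k\<bar> > l}) else \<infinity>)"

(* Valued in ennreal: the infimum over the empty set (unbounded x) is \<infinity>. *)
definition rearr :: "(nat \<Rightarrow> real) \<Rightarrow> nat \<Rightarrow> ennreal" where
  "rearr x n = (INF l\<in>{l. 0 \<le> l \<and> distr_fun x l \<le> enat (n - 1)}. ennreal l)"

definition max_rearr :: "(nat \<Rightarrow> real) \<Rightarrow> nat \<Rightarrow> ennreal" where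
  "max_rearr x n = (\<Sum>i=1..n. rearr x i) / of_nat n"

definition nonneg_weight :: "(nat \<Rightarrow> real) \<Rightarrow> bool" where
  "nonneg_weight w \<longleftrightarrow>
     (\<forall>n\<ge>1. 0 \<le> w n) \<and> (\<exists>n\<ge>1. 0 < w n) \<and>
     (\<forall>n\<ge>1. summable (\<lambda>i. w (n + 1 + i) / real (n + 1 + i)))"

definition lorentz_ennorm :: "(nat \<Rightarrow> real) \<Rightarrow> (nat \<Rightarrow> real) \<Rightarrow> ennreal" where
  "lorentz_ennorm w x = (\<Sum>n. max_rearr x (Suc n) * ennreal (w (Suc n)))"

definition lorentz_space :: "(nat \<Rightarrow> real) \<Rightarrow> (nat \<Rightarrow> real) set" where
  "lorentz_space w = {x \<in> seqs. lorentz_ennorm w x < \<infinity>}"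

definition lorentz_norm :: "(nat \<Rightarrow> real) \<Rightarrow> (nat \<Rightarrow> real) \<Rightarrow> real" where
  "lorentz_norm w x = enn2real (lorentz_ennorm w x)"

definition fund_seq :: "(nat \<Rightarrow> real) \<Rightarrow> nat \<Rightarrow> real" where
  "fund_seq w n = lorentz_norm w (indicator {1..n})"

(* The full dual: all bounded linear functionals on the Lorentz space.  They are taken
   extensional, so that equality of functions is equality of functionals. *)
definition lorentz_dual :: "(nat \<Rightarrow> real) \<Rightarrow> ((nat \<Rightarrow> real) \<Rightarrow> real) set" where
  "lorentz_dual w = {f \<in> extensional (lorentz_space w).
     (\<forall>u\<in>lorentz_space w. \<forall>v\<in>lorentz_space w. f (\<lambda>n. u n + v n) = f u + f v) \<and>
     (\<forall>c. \<forall>u\<in>lorentz_space w. f (\<lambda>n. c * u n) = c * f u) \<and>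
     (\<exists>C. \<forall>u\<in>lorentz_space w. \<bar>f u\<bar> \<le> C * lorentz_norm w u)}"

definition dual_norm :: "(nat \<Rightarrow> real) \<Rightarrow> ((nat \<Rightarrow> real) \<Rightarrow> real) \<Rightarrow> real" where
  "dual_norm w f = (SUP u\<in>{u \<in> lorentz_space w. lorentz_norm w u \<le> 1}. \<bar>f u\<bar>)"

definition dual_sphere :: "(nat \<Rightarrow> real) \<Rightarrow> ((nat \<Rightarrow> real) \<Rightarrow> real) set" where
  "dual_sphere w = {f \<in> lorentz_dual w. dual_norm w f = 1}"

definition dual_ball_extreme :: "(nat \<Rightarrow> real) \<Rightarrow> ((nat \<Rightarrow> real) \<Rightarrow> real) \<Rightarrow> bool" where
  "dual_ball_extreme w f \<longleftrightarrow> f \<in> dual_sphere w \<and>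
     (\<forall>g\<in>dual_sphere w. \<forall>h\<in>dual_sphere w.
        (\<forall>u\<in>lorentz_space w. f u = (g u + h u) / 2) \<longrightarrow> f = g \<and> g = h)"

(* The functional f is the pairing with the sequence y; the pairing series is required to
   converge on the whole Lorentz space. *)
definition represents :: "(nat \<Rightarrow> real) \<Rightarrow> (nat \<Rightarrow> real) \<Rightarrow> ((nat \<Rightarrow> real) \<Rightarrow> real) \<Rightarrow> bool" where
  "represents w y f \<longleftrightarrow> y \<in> seqs \<and> f \<in> lorentz_dual w \<and>
     (\<forall>u\<in>lorentz_space w. (\<lambda>n. u (Suc n) * y (Suc n)) sums f u)"

end

theory Submission
  imports Defs
begin

text \<open>
  Write \<open>V n\<close> (\<open>n = 0, 1, \<dots>\<close>) for the tails \<open>\<Sum>\<^sub>i\<^sub>>\<^sub>n w(i)/i\<close> and \<open>\<Phi> n = V 0 + \<dots> + V (n - 1)\<close>.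
  Interchanging two sums gives \<open>\<Phi> n = W(n) + W\<^sub>1(n)\<close>, the fundamental sequence, and
  \<open>\<parallel>u\<parallel> = \<Sum>\<^sub>i u*(i) V (i - 1)\<close>. A functional is determined on finitely supported
  sequences by its values on the unit vectors; testing it against signs on a finite set \<open>B\<close> shows
  that these coordinates \<open>y\<close> satisfy \<open>\<Sum>\<^sub>k\<^sub>\<in>\<^sub>B \<bar>y k\<bar> \<le> \<Phi> (card B)\<close> if the norm is at most 1
  (\<open>coord_majorized\<close>), and conversely this condition, called \<open>majorized\<close>, gives norm at most 1
  (\<open>pairing_bound\<close>). So, as far as sequences are concerned, the ball is the set of
  all \<open>y\<close> whose decreasing rearrangement is weakly majorized by the decreasing null sequence \<open>V\<close>, and the
  theorem says that its extreme points are the rearrangements of \<open>V\<close> itself. A majorized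
  sequence tends to 0, so \<open>\<bar>x\<bar>\<close> has an injective enumeration \<open>\<sigma>\<close> in decreasing order
  and \<open>x*(n + 1) = \<bar>x (\<sigma> n)\<bar>\<close>.

  Suppose \<open>\<bar>x (\<sigma> n)\<bar> = V n\<close> for all \<open>n\<close>, and let \<open>f\<close> be the midpoint of \<open>g\<close> and \<open>h\<close>. All the
  inequalities for the sets \<open>\<sigma> ` {..<n}\<close> are equalities for \<open>x\<close>, which forces \<open>g\<close> and \<open>h\<close> to have the
  coordinates of \<open>x\<close> (\<open>coord_eq_of_extremal\<close>). It remains to see that \<open>g\<close> has no singular part, that
  is, that \<open>g\<close> is determined by its coordinates (\<open>functional_eq_of_coord\<close>). If \<open>W(\<infinity>) = \<infinity>\<close>, this
  holds because finitely supported sequences are dense. If \<open>W(\<infinity>) < \<infinity>\<close>, the Lorentz space consists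
  of the bounded sequences and there are singular functionals; but then \<open>x\<close> alone already
  exhausts the norm on the sequence \<open>sgn x\<close>, because \<open>\<Sum>\<bar>x k\<bar> = W(\<infinity>)\<close>, and a singular
  part, acting on the tail of a test sequence that is \<open>sgn x\<close> on a long initial segment, would push the
  norm above 1.

  Suppose \<open>\<bar>x (\<sigma> n)\<bar> \<noteq> V n\<close> for some \<open>n\<close>, and let \<open>D n\<close> be the slack \<open>\<Phi> n - \<Sum>\<^sub>i\<^sub><\<^sub>n \<bar>x (\<sigma> i)\<bar> \<ge> 0\<close>.
  It becomes positive immediately after some \<open>p\<close>. Either it is positive up to a position \<open>r\<close> where
  \<open>\<bar>x \<circ> \<sigma>\<bar>\<close> drops strictly, and a small amount can be moved between the
  positions \<open>p\<close> and \<open>r - 1\<close> in either direction; or \<open>x\<close> vanishes beyond position \<open>p\<close>, the slack stays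
  bounded away from 0, and the entry at \<open>p\<close> alone can be changed (\<open>exists_perturbation\<close>). In both
  cases \<open>x\<close> is the midpoint of two distinct majorized sequences.
\<close>

section \<open>Decreasing rearrangements\<close>

lemma rearr_le:
  assumes "0 \<le> c" "finite {k. 1 \<le> k \<and> \<bar>u k\<bar> > c}" "card {k. 1 \<le> k \<and> \<bar>u k\<bar> > c} \<le> n - 1"
  shows "rearr u n \<le> ennreal c"
  unfolding rearr_def
  by (rule INF_lower) (use assms in \<open>auto simp: distr_fun_def\<close>)

lemma rearr_le_bound:
  assumes "0 \<le> c" "\<And>k. 1 \<le> k \<Longrightarrow> \<bar>u k\<bar> \<le> c"
  shows "rearr u n \<le> ennreal c"
proof -
  have "{k. 1 \<le> k \<and> \<bar>u k\<bar> > c} = {}" using assms(2) by force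
  then show ?thesis using assms(1) rearr_le[of c u n] by (metis card.empty finite.emptyI le0)
qed

lemma rearr_ge:
  assumes "finite A" "A \<subseteq> {1..}" "n \<le> card A" "1 \<le> n" "\<And>k. k \<in> A \<Longrightarrow> t \<le> \<bar>u k\<bar>"
  shows "ennreal t \<le> rearr u n"
  unfolding rearr_def
proof (rule INF_greatest)
  fix l assume "l \<in> {l. 0 \<le> l \<and> distr_fun u l \<le> enat (n - 1)}"
  then have l: "0 \<le> l" and d: "finite {k. 1 \<le> k \<and> \<bar>u k\<bar> > l}" "card {k. 1 \<le> k \<and> \<bar>u k\<bar> > l} \<le> n - 1"
    by (auto simp: distr_fun_def split: if_splits)
  have "\<not> A \<subseteq> {k. 1 \<le> k \<and> \<bar>u k\<bar> > l}"
    using card_mono[OF d(1), of A] d(2) assms by linarith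
  then obtain k where "k \<in> A" "\<bar>u k\<bar> \<le> l" using assms(2) by force
  with assms(5) show "ennreal t \<le> ennreal l" by (meson ennreal_leI order_trans)
qed

lemma rearr_mono:
  assumes "\<And>k. 1 \<le> k \<Longrightarrow> \<bar>u k\<bar> \<le> \<bar>v k\<bar>"
  shows "rearr u n \<le> rearr v n"
  unfolding rearr_def
proof (rule INF_superset_mono, safe)
  fix l assume d: "distr_fun v l \<le> enat (n - 1)" and l: "0 \<le> l"
  then have f: "finite {k. 1 \<le> k \<and> \<bar>v k\<bar> > l}" "card {k. 1 \<le> k \<and> \<bar>v k\<bar> > l} \<le> n - 1"
    by (auto simp: distr_fun_def split: if_splits)
  have s: "{k. 1 \<le> k \<and> \<bar>u k\<bar> > l} \<subseteq> {k. 1 \<le> k \<and> \<bar>v k\<bar> > l}" using assms by force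
  show "distr_fun u l \<le> enat (n - 1)"
    using finite_subset[OF s f(1)] card_mono[OF f(1) s] f(2) by (auto simp: distr_fun_def)
qed

lemma rearr_antimono: "m \<le> n \<Longrightarrow> rearr u n \<le> rearr u m"
  unfolding rearr_def
  by (rule INF_superset_mono) (auto intro: order_trans)

lemma sum_abs_le_sum_rearr:
  assumes "finite A" "A \<subseteq> {1..}"
  shows "ennreal (\<Sum>k\<in>A. \<bar>u k\<bar>) \<le> (\<Sum>i<card A. rearr u (Suc i))"
  using assms
proof (induction "card A" arbitrary: A)
  case 0
  then show ?case by simp
next
  case (Suc n)
  then have "A \<noteq> {}" by auto
  \<comment> \<open>An entry of least modulus in \<open>A\<close> is at most the \<open>card A\<close>-th rearranged value.\<close>
  define k where "k = arg_min_on (\<lambda>k. \<bar>u k\<bar>) A"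
  have k: "k \<in> A" "\<And>j. j \<in> A \<Longrightarrow> \<bar>u k\<bar> \<le> \<bar>u j\<bar>"
    using arg_min_if_finite(1)[OF Suc.prems(1) \<open>A \<noteq> {}\<close>, of "\<lambda>k. \<bar>u k\<bar>"]
      arg_min_least[OF Suc.prems(1) \<open>A \<noteq> {}\<close>, of _ "\<lambda>k. \<bar>u k\<bar>"] by (auto simp: k_def)
  have c: "card (A - {k}) = n" using k(1) Suc by simp
  have "ennreal \<bar>u k\<bar> \<le> rearr u (Suc n)"
    by (rule rearr_ge[of A]) (use Suc k in auto)
  moreover have "ennreal (\<Sum>k\<in>A - {k}. \<bar>u k\<bar>) \<le> (\<Sum>i<n. rearr u (Suc i))"
    using Suc.hyps(1)[of "A - {k}"] c Suc.prems by auto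
  moreover have "(\<Sum>k\<in>A. \<bar>u k\<bar>) = (\<Sum>k\<in>A - {k}. \<bar>u k\<bar>) + \<bar>u k\<bar>"
    using k(1) Suc.prems by (simp add: sum.remove)
  ultimately show ?case
    unfolding Suc.hyps(2)[symmetric] by (simp add: add_mono sum_nonneg)
qed

lemma rearr_scale: "rearr (\<lambda>k. c * u k) n \<le> ennreal \<bar>c\<bar> * rearr u n"
proof (cases "c = 0")
  case True
  then show ?thesis using rearr_le_bound[of 0 "\<lambda>k. c * u k" n] by simp
next
  case False
  have "rearr (\<lambda>k. c * u k) n / ennreal \<bar>c\<bar> \<le> rearr u n"
    unfolding rearr_def[of u]
  proof (rule INF_greatest)
    fix l assume "l \<in> {l. 0 \<le> l \<and> distr_fun u l \<le> enat (n - 1)}"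
    then have l: "0 \<le> l" and d: "finite {k. 1 \<le> k \<and> \<bar>u k\<bar> > l}" "card {k. 1 \<le> k \<and> \<bar>u k\<bar> > l} \<le> n - 1"
      by (auto simp: distr_fun_def split: if_splits)
    have e: "{k. 1 \<le> k \<and> \<bar>c * u k\<bar> > \<bar>c\<bar> * l} = {k. 1 \<le> k \<and> \<bar>u k\<bar> > l}"
      using False by (auto simp: abs_mult)
    have "rearr (\<lambda>k. c * u k) n \<le> ennreal (\<bar>c\<bar> * l)"
      by (rule rearr_le) (use l d e in auto)
    also have "\<dots> = ennreal \<bar>c\<bar> * ennreal l" using l by (simp add: ennreal_mult)
    finally show "rearr (\<lambda>k. c * u k) n / ennreal \<bar>c\<bar> \<le> ennreal l"
      using False by (subst divide_le_posI_ennreal) (auto simp: mult.commute)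
  qed
  then have "ennreal \<bar>c\<bar> * (rearr (\<lambda>k. c * u k) n / ennreal \<bar>c\<bar>) \<le> ennreal \<bar>c\<bar> * rearr u n"
    by (rule mult_left_mono) simp
  moreover have "ennreal \<bar>c\<bar> * (r / ennreal \<bar>c\<bar>) = r" for r
    using False by (simp add: ennreal_times_divide mult_divide_eq_ennreal mult.commute)
  ultimately show ?thesis by simp
qed

text \<open>
  Counting the entries above \<open>a + b\<close> by those of \<open>u\<close> above \<open>a\<close> and those of \<open>v\<close> above \<open>b\<close>.
  This is what makes the Lorentz space closed under addition.
\<close>

lemma rearr_add: "rearr (\<lambda>k. u k + v k) (Suc (i + j)) \<le> rearr u (Suc i) + rearr v (Suc j)"
proof -
  have *: "rearr (\<lambda>k. u k + v k) (Suc (i + j)) \<le> ennreal a + ennreal b"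
    if "0 \<le> a" "distr_fun u a \<le> enat i" "0 \<le> b" "distr_fun v b \<le> enat j" for a b
  proof -
    have f: "finite {k. 1 \<le> k \<and> \<bar>u k\<bar> > a}" "card {k. 1 \<le> k \<and> \<bar>u k\<bar> > a} \<le> i"
       "finite {k. 1 \<le> k \<and> \<bar>v k\<bar> > b}" "card {k. 1 \<le> k \<and> \<bar>v k\<bar> > b} \<le> j"
      using that by (auto simp: distr_fun_def split: if_splits)
    have s: "{k. 1 \<le> k \<and> \<bar>u k + v k\<bar> > a + b} \<subseteq> {k. 1 \<le> k \<and> \<bar>u k\<bar> > a} \<union> {k. 1 \<le> k \<and> \<bar>v k\<bar> > b}"
      by auto
    have "card {k. 1 \<le> k \<and> \<bar>u k + v k\<bar> > a + b} \<le> i + j"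
      using card_mono[OF _ s] card_Un_le[of "{k. 1 \<le> k \<and> \<bar>u k\<bar> > a}" "{k. 1 \<le> k \<and> \<bar>v k\<bar> > b}"] f
      by (metis (no_types, lifting) add_mono finite_UnI le_trans)
    moreover have "finite {k. 1 \<le> k \<and> \<bar>u k + v k\<bar> > a + b}"
      using finite_subset[OF s] f by simp
    ultimately have "rearr (\<lambda>k. u k + v k) (Suc (i + j)) \<le> ennreal (a + b)"
      using that by (intro rearr_le) auto
    then show ?thesis using that by simp
  qed
  show ?thesis
  proof (cases "rearr u (Suc i) = top \<or> rearr v (Suc j) = top")
    case True
    then show ?thesis by auto
  next
    case False
    show ?thesis
    proof (rule ennreal_le_epsilon)
      fix e :: real assume "0 < e"
      then have e: "0 < ennreal (e/2)" by simp
      obtain a where a: "0 \<le> a" "distr_fun u a \<le> enat i" "ennreal a < rearr u (Suc i) + ennreal (e/2)"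
        using False e INF_less_iff[of "\<lambda>l. ennreal l" "{l. 0 \<le> l \<and> distr_fun u l \<le> enat (Suc i - 1)}" "rearr u (Suc i) + ennreal (e/2)"]
        by (auto simp: rearr_def ennreal_add_left_cancel_less)
      obtain b where b: "0 \<le> b" "distr_fun v b \<le> enat j" "ennreal b < rearr v (Suc j) + ennreal (e/2)"
        using False e INF_less_iff[of "\<lambda>l. ennreal l" "{l. 0 \<le> l \<and> distr_fun v l \<le> enat (Suc j - 1)}" "rearr v (Suc j) + ennreal (e/2)"]
        by (auto simp: rearr_def ennreal_add_left_cancel_less)
      have "ennreal (e/2) + ennreal (e/2) = ennreal e"
        using \<open>0 < e\<close> by (subst ennreal_plus[symmetric]) auto
      then have "(rearr u (Suc i) + ennreal (e/2)) + (rearr v (Suc j) + ennreal (e/2))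
          = rearr u (Suc i) + rearr v (Suc j) + ennreal e"
        by (metis (no_types, lifting) add.assoc add.commute)
      with *[OF a(1,2) b(1,2)] add_mono[OF less_imp_le[OF a(3)] less_imp_le[OF b(3)]]
      show "rearr (\<lambda>k. u k + v k) (Suc (i + j)) \<le> rearr u (Suc i) + rearr v (Suc j) + ennreal e"
        by simp
    qed
  qed
qed


text \<open>
  Summation by parts: weights that decrease cannot spoil the sign of a sum all of whose initial
  segments are nonnegative. The factor \<open>c n\<close> on the left is what the induction needs.
\<close>

lemma abel_dominated:
  fixes c d :: "nat \<Rightarrow> real"
  assumes "\<And>m. m \<le> Suc n \<Longrightarrow> 0 \<le> (\<Sum>i<m. d i)" "\<And>i. i < n \<Longrightarrow> c (Suc i) \<le> c i"
  shows "c n * (\<Sum>i<Suc n. d i) \<le> (\<Sum>i<Suc n. c i * d i)"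
  using assms
proof (induction n)
  case 0
  then show ?case by simp
next
  case (Suc n)
  have "c (Suc n) * (\<Sum>i<Suc n. d i) \<le> c n * (\<Sum>i<Suc n. d i)"
    using Suc.prems(1)[of "Suc n"] Suc.prems(2)[of n] by (intro mult_right_mono) auto
  also have "\<dots> \<le> (\<Sum>i<Suc n. c i * d i)" by (rule Suc.IH) (use Suc.prems in auto)
  finally have "c (Suc n) * (\<Sum>i<Suc n. d i) \<le> (\<Sum>i<Suc n. c i * d i)" .
  then show ?case
    by (simp only: sum.lessThan_Suc[of _ "Suc n"] distrib_left add_le_cancel_right)
qed

section \<open>The weight and the Lorentz norm\<close>

definition cut :: "nat set \<Rightarrow> (nat \<Rightarrow> real) \<Rightarrow> nat \<Rightarrow> real" where
  "cut A u = (\<lambda>k. if k \<in> A then u k else 0)"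

text \<open>
  The value 0 at index 0 makes this a sequence in the sense of \<open>seqs\<close>.
\<close>

definition coord :: "((nat \<Rightarrow> real) \<Rightarrow> real) \<Rightarrow> nat \<Rightarrow> real" where
  "coord f k = (if k = 0 then 0 else f (indicator {k}))"

locale lorentz_weight =
  fixes w :: "nat \<Rightarrow> real"
  assumes weight: "nonneg_weight w"
begin

definition q :: "nat \<Rightarrow> real" where
  "q j = w (Suc j) / real (Suc j)"

text \<open>
  \<open>V n\<close> is the series \<open>\<Sum>\<^sub>i\<^sub>\<ge>\<^sub>m w(i)/i\<close> for \<open>m = n + 1\<close>: positions are counted from 0 here, so
  \<open>V n\<close> is the value prescribed for \<open>x*(n + 1)\<close>.
\<close>

definition V :: "nat \<Rightarrow> real" where
  "V n = (\<Sum>i. q (n + i))"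

text \<open>
  The fundamental sequence \<open>W(n) + W\<^sub>1(n)\<close> of the Lorentz space, written as a sum of the decreasing
  sequence \<open>V\<close>; the equality is \<open>\<Phi>_eq\<close>.
\<close>

definition \<Phi> :: "nat \<Rightarrow> real" where
  "\<Phi> n = (\<Sum>i<n. V i)"

lemma w_nonneg: "0 \<le> w (Suc j)"
  using weight by (auto simp: nonneg_weight_def)

lemma q_nonneg: "0 \<le> q j"
  by (simp add: q_def w_nonneg)

lemma summable_q: "summable q"
proof -
  have "summable (\<lambda>i. w (1 + 1 + i) / real (1 + 1 + i))"
    using weight unfolding nonneg_weight_def by blast
  then have "summable (\<lambda>i. q (Suc i))" by (simp add: q_def)
  then show ?thesis by (simp only: summable_Suc_iff)
qed

lemma summable_q_tail: "summable (\<lambda>i. q (n + i))"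
  using summable_ignore_initial_segment[OF summable_q, of n] by (simp add: add.commute)

lemma V_nonneg: "0 \<le> V n"
  unfolding V_def by (rule suminf_nonneg[OF summable_q_tail q_nonneg])

lemma V_Suc: "V n = q n + V (Suc n)"
  unfolding V_def using suminf_split_head[OF summable_q_tail, of n] by simp

lemma V_antimono: "m \<le> n \<Longrightarrow> V n \<le> V m"
  by (rule lift_Suc_antimono_le[of V]) (metis V_Suc q_nonneg le_add_same_cancel2)

lemma V_eq: "V n = suminf q - (\<Sum>i<n. q i)"
  unfolding V_def using suminf_minus_initial_segment[OF summable_q, of n] by (simp add: add.commute)

lemma V_tendsto_0: "V \<longlonglongrightarrow> 0"
proof -
  have "(\<lambda>n. suminf q - (\<Sum>i<n. q i)) \<longlonglongrightarrow> suminf q - suminf q"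
    by (intro tendsto_intros summable_LIMSEQ summable_q)
  then show ?thesis by (simp add: V_eq[abs_def])
qed

lemma \<Phi>_Suc: "\<Phi> (Suc n) = \<Phi> n + V n"
  by (simp add: \<Phi>_def)

lemma \<Phi>_0 [simp]: "\<Phi> 0 = 0"
  by (simp add: \<Phi>_def)

lemma \<Phi>_nonneg: "0 \<le> \<Phi> n"
  by (simp add: \<Phi>_def sum_nonneg V_nonneg)

lemma ennreal_V: "ennreal (V n) = (\<Sum>j. if n \<le> j then ennreal (q j) else 0)"
proof -
  let ?g = "\<lambda>j. if n \<le> j then q j else 0"
  have s: "summable ?g"
    by (rule summable_comparison_test[OF _ summable_q]) (auto simp: q_nonneg)
  have "(\<Sum>j. if n \<le> j then ennreal (q j) else 0) = (\<Sum>j. ennreal (?g j))"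
    by (intro suminf_cong) auto
  also have "\<dots> = ennreal (suminf ?g)"
    by (rule suminf_ennreal2[OF _ s]) (auto simp: q_nonneg)
  also have "suminf ?g = V n"
    using suminf_split_initial_segment[OF s, of n] by (simp add: V_def add.commute)
  finally show ?thesis by simp
qed

text \<open>
  Interchanging summation. With \<open>c\<close> a decreasing rearrangement the right-hand side is a partial form
  of the Lorentz norm, so the norm is the weighted sum of the rearrangement with weights \<open>V\<close>.
\<close>

lemma sum_V_eq_suminf:
  fixes c :: "nat \<Rightarrow> ennreal"
  shows "(\<Sum>i<n. c i * ennreal (V i)) = (\<Sum>j. (\<Sum>i<min n (Suc j). c i) * ennreal (q j))"
proof -
  have "(\<Sum>i<n. c i * ennreal (V i)) = (\<Sum>i<n. \<Sum>j. c i * (if i \<le> j then ennreal (q j) else 0))"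
    by (simp add: ennreal_V ennreal_suminf_cmult)
  also have "\<dots> = (\<Sum>j. \<Sum>i<n. c i * (if i \<le> j then ennreal (q j) else 0))"
    by (rule suminf_sum[symmetric]) simp
  also have "\<dots> = (\<Sum>j. (\<Sum>i<min n (Suc j). c i) * ennreal (q j))"
  proof (rule suminf_cong)
    fix j
    have "(\<Sum>i<n. c i * (if i \<le> j then ennreal (q j) else 0))
        = (\<Sum>i<n. if i \<le> j then c i * ennreal (q j) else 0)"
      by (rule sum.cong) auto
    also have "\<dots> = (\<Sum>i\<in>{..<n} \<inter> {i. i \<le> j}. c i * ennreal (q j))"
      by (simp add: sum.inter_restrict)
    also have "{..<n} \<inter> {i. i \<le> j} = {..<min n (Suc j)}" by auto
    finally show "(\<Sum>i<n. c i * (if i \<le> j then ennreal (q j) else 0))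
        = (\<Sum>i<min n (Suc j). c i) * ennreal (q j)"
      by (simp add: sum_distrib_right)
  qed
  finally show ?thesis .
qed

text \<open>
  Absorbing the averaging factor of the maximal rearrangement into the weight leaves sums of the
  rearrangement, which are far easier to estimate.
\<close>

lemma ennorm_eq: "lorentz_ennorm w u = (\<Sum>n. (\<Sum>i<Suc n. rearr u (Suc i)) * ennreal (q n))"
  unfolding lorentz_ennorm_def
proof (rule suminf_cong)
  fix n
  have e: "(\<Sum>i=1..Suc n. rearr u i) = (\<Sum>i<Suc n. rearr u (Suc i))"
    by (simp only: One_nat_def lessThan_atLeast0 sum.shift_bounds_Suc_ivl atLeastLessThanSuc_atLeastAtMost[symmetric])
  have "ennreal (q n) = ennreal (w (Suc n)) / of_nat (Suc n)"
    by (simp add: q_def w_nonneg divide_ennreal[symmetric] ennreal_of_nat_eq_real_of_nat del: of_nat_Suc)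
  then show "max_rearr u (Suc n) * ennreal (w (Suc n)) = (\<Sum>i<Suc n. rearr u (Suc i)) * ennreal (q n)"
    unfolding max_rearr_def e by (simp add: ennreal_divide_times ennreal_times_divide)
qed

lemma ennorm_le:
  assumes "\<And>n. (\<Sum>i<Suc n. rearr u (Suc i)) \<le> r n"
  shows "lorentz_ennorm w u \<le> (\<Sum>n. r n * ennreal (q n))"
  unfolding ennorm_eq by (intro suminf_le mult_right_mono assms) auto

lemma ennorm_scale: "lorentz_ennorm w (\<lambda>k. c * u k) \<le> ennreal \<bar>c\<bar> * lorentz_ennorm w u"
proof -
  have "lorentz_ennorm w (\<lambda>k. c * u k) \<le> (\<Sum>n. (ennreal \<bar>c\<bar> * (\<Sum>i<Suc n. rearr u (Suc i))) * ennreal (q n))"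
    by (rule ennorm_le) (unfold sum_distrib_left, intro sum_mono rearr_scale)
  also have "\<dots> = ennreal \<bar>c\<bar> * lorentz_ennorm w u"
    by (simp only: ennorm_eq mult.assoc ennreal_suminf_cmult)
  finally show ?thesis .
qed

text \<open>
  The constant 2 is not optimal. It comes from \<open>(u + v)*(2i - 1) \<le> u*(i) + v*(i)\<close>: bounding a sum of
  \<open>n\<close> terms by one of \<open>2n\<close> terms and grouping these in pairs costs a factor 2, which is harmless
  for showing that the space is closed under addition.
\<close>

lemma ennorm_add: "lorentz_ennorm w (\<lambda>k. u k + v k) \<le> 2 * (lorentz_ennorm w u + lorentz_ennorm w v)"
proof -
  let ?r = "\<lambda>i. rearr (\<lambda>k. u k + v k) (Suc i)"
  let ?a = "\<lambda>i. rearr u (Suc i)" and ?b = "\<lambda>i. rearr v (Suc i)"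
  have "lorentz_ennorm w (\<lambda>k. u k + v k) \<le> (\<Sum>n. (2 * ((\<Sum>i<Suc n. ?a i) + (\<Sum>i<Suc n. ?b i))) * ennreal (q n))"
  proof (rule ennorm_le)
    fix n
    have pair: "(\<Sum>i<2 * N. ?r i) = (\<Sum>i<N. ?r (i + i) + ?r (Suc (i + i)))" for N
      by (induction N) (simp_all add: mult_2 add.assoc)
    have "(\<Sum>i<Suc n. ?r i) \<le> (\<Sum>i<2 * Suc n. ?r i)" by (rule sum_mono2) auto
    also have "\<dots> \<le> (\<Sum>i<Suc n. 2 * (?a i + ?b i))"
      unfolding pair
    proof (rule sum_mono)
      fix i
      have "?r (Suc (i + i)) \<le> ?r (i + i)" by (rule rearr_antimono) simp
      moreover have "?r (i + i) \<le> ?a i + ?b i" by (rule rearr_add)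
      ultimately show "?r (i + i) + ?r (Suc (i + i)) \<le> 2 * (?a i + ?b i)"
        unfolding mult_2 by (meson add_mono order_trans)
    qed
    finally show "(\<Sum>i<Suc n. ?r i) \<le> 2 * ((\<Sum>i<Suc n. ?a i) + (\<Sum>i<Suc n. ?b i))"
      by (simp only: sum_distrib_left[symmetric] sum.distrib)
  qed
  also have "\<dots> = 2 * (lorentz_ennorm w u + lorentz_ennorm w v)"
    unfolding ennorm_eq
    by (simp only: mult.assoc ennreal_suminf_cmult distrib_right suminf_add[symmetric] summableI)
  finally show ?thesis .
qed

text \<open>
  The rearrangement lies below \<open>c\<close> times the indicator of the first \<open>card A\<close> positions, whose norm is
  \<open>\<Phi> (card A)\<close>.
\<close>

lemma ennorm_finite_support:
  assumes "finite A" "A \<subseteq> {1..}" "0 \<le> c" "\<And>k. k \<in> A \<Longrightarrow> \<bar>u k\<bar> \<le> c" "\<And>k. 1 \<le> k \<Longrightarrow> k \<notin> A \<Longrightarrow> u k = 0"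
  shows "lorentz_ennorm w u \<le> ennreal (c * \<Phi> (card A))"
proof -
  have r: "rearr u (Suc i) \<le> (if i < card A then ennreal c else 0)" for i
  proof (cases "i < card A")
    case True
    have "\<bar>u k\<bar> \<le> c" if "1 \<le> k" for k using assms(3) assms(4)[of k] assms(5)[OF that] by (cases "k \<in> A") auto
    then show ?thesis using True rearr_le_bound[OF assms(3)] by simp
  next
    case False
    have s: "{k. 1 \<le> k \<and> 0 < \<bar>u k\<bar>} \<subseteq> A" using assms(5) by force
    have "rearr u (Suc i) \<le> ennreal 0"
      by (rule rearr_le) (use card_mono[OF assms(1) s] finite_subset[OF s assms(1)] False in auto)
    then show ?thesis using False by simp
  qed
  have "lorentz_ennorm w u \<le> (\<Sum>n. (\<Sum>i<min (card A) (Suc n). ennreal c) * ennreal (q n))"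
  proof (rule ennorm_le)
    fix n
    have "(\<Sum>i<Suc n. rearr u (Suc i)) \<le> (\<Sum>i<Suc n. if i < card A then ennreal c else 0)"
      by (intro sum_mono r)
    also have "\<dots> = (\<Sum>i\<in>{..<Suc n} \<inter> {i. i < card A}. ennreal c)"
      by (simp only: sum.inter_restrict finite_lessThan mem_Collect_eq)
    also have "{..<Suc n} \<inter> {i. i < card A} = {..<min (card A) (Suc n)}" by auto
    finally show "(\<Sum>i<Suc n. rearr u (Suc i)) \<le> (\<Sum>i<min (card A) (Suc n). ennreal c)" .
  qed
  also have "\<dots> = (\<Sum>i<card A. ennreal c * ennreal (V i))"
    by (rule sum_V_eq_suminf[symmetric])
  also have "\<dots> = ennreal (c * \<Phi> (card A))"
    using assms(3) by (simp add: \<Phi>_def sum_distrib_left ennreal_mult[symmetric] V_nonneg)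
  finally show ?thesis .
qed

text \<open>
  The rearrangement and all its averages are at most \<open>c\<close>. So every sequence of signs is an admissible test
  sequence of norm at most \<open>W(\<infinity>)\<close>, whatever its tail looks like.
\<close>

lemma ennorm_bounded:
  assumes "summable (\<lambda>j. w (Suc j))" "0 \<le> c" "\<And>k. 1 \<le> k \<Longrightarrow> \<bar>u k\<bar> \<le> c"
  shows "lorentz_ennorm w u \<le> ennreal (c * (\<Sum>j. w (Suc j)))"
proof -
  have "lorentz_ennorm w u \<le> (\<Sum>n. ennreal (c * real (Suc n)) * ennreal (q n))"
  proof (rule ennorm_le)
    fix n
    have "(\<Sum>i<Suc n. rearr u (Suc i)) \<le> (\<Sum>i<Suc n. ennreal c)"
      by (intro sum_mono rearr_le_bound assms)
    also have "\<dots> = ennreal (\<Sum>i<Suc n. c)" using assms(2) by (subst sum_ennreal) auto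
    finally show "(\<Sum>i<Suc n. rearr u (Suc i)) \<le> ennreal (c * real (Suc n))"
      by (simp add: mult.commute)
  qed
  also have "\<dots> = (\<Sum>n. ennreal (c * w (Suc n)))"
    using assms(2) by (intro suminf_cong) (simp add: ennreal_mult[symmetric] q_nonneg, simp add: q_def)
  also have "\<dots> = ennreal (\<Sum>n. c * w (Suc n))"
    using assms(1,2) by (intro suminf_ennreal2 summable_mult) (auto simp: w_nonneg)
  also have "(\<Sum>n. c * w (Suc n)) = c * (\<Sum>j. w (Suc j))"
    by (rule suminf_mult[OF assms(1)])
  finally show ?thesis .
qed

abbreviation "\<gamma> \<equiv> lorentz_space w"

lemma ennreal_lorentz_norm: "u \<in> \<gamma> \<Longrightarrow> ennreal (lorentz_norm w u) = lorentz_ennorm w u"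
  by (simp add: lorentz_space_def lorentz_norm_def)

lemma in_space_norm_le:
  assumes "u 0 = 0" "lorentz_ennorm w u \<le> ennreal c" "0 \<le> c"
  shows "u \<in> \<gamma>" "lorentz_norm w u \<le> c"
  using assms order.strict_trans1[OF assms(2)]
  by (auto simp: lorentz_space_def seqs_def lorentz_norm_def intro: enn2real_leI)

lemma norm_nonneg: "0 \<le> lorentz_norm w u"
  by (simp add: lorentz_norm_def)

lemma space_0: "u \<in> \<gamma> \<Longrightarrow> u 0 = 0"
  by (simp add: lorentz_space_def seqs_def)

lemma space_scale:
  assumes "u \<in> \<gamma>"
  shows "(\<lambda>k. c * u k) \<in> \<gamma>" "lorentz_norm w (\<lambda>k. c * u k) \<le> \<bar>c\<bar> * lorentz_norm w u"
proof -
  have "lorentz_ennorm w (\<lambda>k. c * u k) \<le> ennreal (\<bar>c\<bar> * lorentz_norm w u)"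
    using ennorm_scale[of c u] assms by (simp add: ennreal_mult norm_nonneg ennreal_lorentz_norm)
  with space_0[OF assms] show "(\<lambda>k. c * u k) \<in> \<gamma>" "lorentz_norm w (\<lambda>k. c * u k) \<le> \<bar>c\<bar> * lorentz_norm w u"
    by (auto intro!: in_space_norm_le simp: norm_nonneg)
qed

lemma space_add:
  assumes "u \<in> \<gamma>" "v \<in> \<gamma>"
  shows "(\<lambda>k. u k + v k) \<in> \<gamma>"
proof (rule in_space_norm_le(1))
  show "lorentz_ennorm w (\<lambda>k. u k + v k) \<le> ennreal (2 * (lorentz_norm w u + lorentz_norm w v))"
  proof -
    have "ennreal (2 * (lorentz_norm w u + lorentz_norm w v)) = 2 * (lorentz_ennorm w u + lorentz_ennorm w v)"
      unfolding ennreal_lorentz_norm[OF assms(1), symmetric] ennreal_lorentz_norm[OF assms(2), symmetric]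
      by (simp only: ennreal_mult'[of 2] ennreal_plus norm_nonneg ennreal_numeral zero_le_numeral)
    then show ?thesis using ennorm_add[of u v] by simp
  qed
qed (use assms in \<open>auto simp: space_0 norm_nonneg\<close>)


section \<open>Functionals and their coordinates\<close>

text \<open>
  Quantifying over finite sets expresses that the decreasing rearrangement of \<open>y\<close> is weakly majorized by \<open>V\<close>
  without choosing a rearrangement.
\<close>

definition majorized :: "(nat \<Rightarrow> real) \<Rightarrow> bool" where
  "majorized y \<longleftrightarrow> (\<forall>B. finite B \<longrightarrow> B \<subseteq> {1..} \<longrightarrow> (\<Sum>k\<in>B. \<bar>y k\<bar>) \<le> \<Phi> (card B))"

lemma majorizedD: "majorized y \<Longrightarrow> finite B \<Longrightarrow> B \<subseteq> {1..} \<Longrightarrow> (\<Sum>k\<in>B. \<bar>y k\<bar>) \<le> \<Phi> (card B)"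
  by (auto simp: majorized_def)

lemma cut_finite:
  assumes "finite A" "A \<subseteq> {1..}" "0 \<le> c" "\<And>k. k \<in> A \<Longrightarrow> \<bar>u k\<bar> \<le> c"
  shows "cut A u \<in> \<gamma>" "lorentz_norm w (cut A u) \<le> c * \<Phi> (card A)"
proof -
  have "lorentz_ennorm w (cut A u) \<le> ennreal (c * \<Phi> (card A))"
    by (rule ennorm_finite_support) (use assms in \<open>auto simp: cut_def\<close>)
  moreover have "cut A u 0 = 0" using assms(2) by (auto simp: cut_def)
  ultimately show "cut A u \<in> \<gamma>" "lorentz_norm w (cut A u) \<le> c * \<Phi> (card A)"
    using in_space_norm_le assms(3) \<Phi>_nonneg by (meson mult_nonneg_nonneg)+
qed

lemma cut_finite_in_space: "finite A \<Longrightarrow> A \<subseteq> {1..} \<Longrightarrow> cut A u \<in> \<gamma>"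
  by (rule cut_finite(1)[of A "\<Sum>k\<in>A. \<bar>u k\<bar>"]) (auto simp: sum_nonneg intro: member_le_sum)

lemma indicator_in_space: "1 \<le> k \<Longrightarrow> indicator {k} \<in> \<gamma>"
  using cut_finite_in_space[of "{k}" "\<lambda>_. 1"]
  by (simp add: cut_def indicator_def[abs_def] of_bool_def)

lemma cut_in_space:
  assumes "u \<in> \<gamma>"
  shows "cut A u \<in> \<gamma>"
proof (rule in_space_norm_le(1))
  have "lorentz_ennorm w (cut A u) \<le> lorentz_ennorm w u"
    unfolding ennorm_eq[of u]
    by (intro ennorm_le sum_mono rearr_mono) (simp add: cut_def)
  then show "lorentz_ennorm w (cut A u) \<le> ennreal (lorentz_norm w u)"
    using assms by (simp add: ennreal_lorentz_norm)
qed (use assms in \<open>auto simp: cut_def space_0 norm_nonneg\<close>)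

context
  fixes f
  assumes f: "f \<in> lorentz_dual w"
begin

lemma dual_add: "u \<in> \<gamma> \<Longrightarrow> v \<in> \<gamma> \<Longrightarrow> f (\<lambda>k. u k + v k) = f u + f v"
  using f by (auto simp: lorentz_dual_def)

lemma dual_scale: "u \<in> \<gamma> \<Longrightarrow> f (\<lambda>k. c * u k) = c * f u"
  using f by (auto simp: lorentz_dual_def)

lemma dual_bdd: "bdd_above ((\<lambda>u. \<bar>f u\<bar>) ` {u \<in> \<gamma>. lorentz_norm w u \<le> 1})"
proof -
  obtain C where C: "\<And>u. u \<in> \<gamma> \<Longrightarrow> \<bar>f u\<bar> \<le> C * lorentz_norm w u"
    using f unfolding lorentz_dual_def by blast
  show ?thesis
  proof (rule bdd_aboveI2)
    fix u assume u: "u \<in> {u \<in> \<gamma>. lorentz_norm w u \<le> 1}"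
    have "C * lorentz_norm w u \<le> \<bar>C\<bar> * 1"
      using u by (intro mult_mono) (auto simp: norm_nonneg)
    then show "\<bar>f u\<bar> \<le> \<bar>C\<bar>" using C[of u] u by auto
  qed
qed

lemma dual_bound:
  assumes u: "u \<in> \<gamma>"
  shows "\<bar>f u\<bar> \<le> dual_norm w f * lorentz_norm w u"
proof (cases "lorentz_norm w u = 0")
  case True
  then show ?thesis using f u by (auto simp: lorentz_dual_def)
next
  case False
  let ?n = "lorentz_norm w u" and ?v = "\<lambda>k. (1 / lorentz_norm w u) * u k"
  have n: "0 < ?n" using False norm_nonneg[of u] by simp
  then have "lorentz_norm w ?v \<le> 1" using space_scale(2)[OF u, of "1 / ?n"] by simp
  moreover have "?v \<in> \<gamma>" by (rule space_scale[OF u])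
  ultimately have "\<bar>f ?v\<bar> \<le> dual_norm w f"
    unfolding dual_norm_def by (intro cSUP_upper dual_bdd) auto
  moreover have "f ?v = (1 / ?n) * f u" by (rule dual_scale[OF u])
  ultimately have "\<bar>(1 / ?n) * f u\<bar> \<le> dual_norm w f" by simp
  then show ?thesis using n by (simp add: abs_mult divide_le_eq)
qed

lemma dual_finite_sum:
  assumes "finite A" "A \<subseteq> {1..}"
  shows "f (cut A c) = (\<Sum>k\<in>A. c k * coord f k)"
  using assms
proof (induction rule: finite_induct)
  case empty
  have "cut {} c = (\<lambda>k. 0 * indicator {1} k)" by (simp add: cut_def)
  then show ?case using dual_scale[OF indicator_in_space, of 1 0] by simp
next
  case (insert a A)
  have e: "cut (insert a A) c = (\<lambda>k. c a * indicator {a} k + cut A c k)"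
    using insert.hyps by (auto simp: cut_def fun_eq_iff indicator_def)
  have a: "1 \<le> a" using insert by auto
  have "f (cut (insert a A) c) = f (\<lambda>k. c a * indicator {a} k) + f (cut A c)"
    unfolding e
    by (intro dual_add space_scale indicator_in_space cut_finite_in_space) (use insert a in auto)
  then show ?case
    using insert a by (simp add: dual_scale[OF indicator_in_space] coord_def)
qed

end

lemma dual_norm_le:
  assumes "\<And>u. u \<in> \<gamma> \<Longrightarrow> \<bar>f u\<bar> \<le> C * lorentz_norm w u" "0 \<le> C"
  shows "dual_norm w f \<le> C"
  unfolding dual_norm_def
proof (rule cSUP_least)
  have "cut {} (\<lambda>_. 0) \<in> \<gamma>" "lorentz_norm w (cut {} (\<lambda>_. 0)) \<le> 0 * \<Phi> (card {})"
    using cut_finite[of "{}" 0 "\<lambda>_. 0"] by simp_all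
  then show "{u \<in> \<gamma>. lorentz_norm w u \<le> 1} \<noteq> {}" by force
next
  fix u assume "u \<in> {u \<in> \<gamma>. lorentz_norm w u \<le> 1}"
  then show "\<bar>f u\<bar> \<le> C" using assms(1)[of u] mult_left_mono[OF _ assms(2), of "lorentz_norm w u" 1] by simp
qed

text \<open>
  Test the functional on the sign pattern of its coordinates on \<open>B\<close>, a sequence of norm at most
  \<open>\<Phi> (card B)\<close>.
\<close>

lemma coord_majorized:
  assumes "f \<in> lorentz_dual w" "dual_norm w f \<le> 1"
  shows "majorized (coord f)"
  unfolding majorized_def
proof (intro allI impI)
  fix B :: "nat set" assume B: "finite B" "B \<subseteq> {1..}"
  let ?u = "cut B (\<lambda>k. sgn (coord f k))"
  have u: "?u \<in> \<gamma>" "lorentz_norm w ?u \<le> 1 * \<Phi> (card B)"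
    using cut_finite[OF B, of 1 "\<lambda>k. sgn (coord f k)"] by (simp_all add: abs_sgn_eq)
  have "(\<Sum>k\<in>B. \<bar>coord f k\<bar>) = f ?u"
    by (simp add: dual_finite_sum[OF assms(1) B] linordered_idom_class.abs_sgn mult.commute)
  also have "\<dots> \<le> dual_norm w f * lorentz_norm w ?u"
    using dual_bound[OF assms(1) u(1)] by simp
  also have "\<dots> \<le> 1 * lorentz_norm w ?u"
    by (rule mult_right_mono[OF assms(2) norm_nonneg])
  finally show "(\<Sum>k\<in>B. \<bar>coord f k\<bar>) \<le> \<Phi> (card B)" using u(2) by simp
qed

lemma represents_coord:
  assumes "represents w x f"
  shows "coord f = x"
proof
  fix k
  show "coord f k = x k"
  proof (cases k)
    case 0
    then show ?thesis using assms by (simp add: represents_def seqs_def coord_def)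
  next
    case (Suc m)
    have "(\<lambda>n. indicator {k} (Suc n) * x (Suc n)) sums f (indicator {k})"
      using assms indicator_in_space[of k] Suc by (simp add: represents_def)
    moreover have "(\<lambda>n. indicator {k} (Suc n) * x (Suc n)) = (\<lambda>n. if n = m then x (Suc n) else 0)"
      using Suc by (auto simp: fun_eq_iff indicator_def)
    ultimately have "f (indicator {k}) = x (Suc m)"
      using sums_unique2[OF _ sums_single[of m "\<lambda>n. x (Suc n)"]] by simp
    then show ?thesis using Suc by (simp add: coord_def)
  qed
qed

section \<open>Hoelder inequality\<close>

text \<open>
  Sort \<open>B\<close> by decreasing modulus of \<open>u\<close>. Majorization bounds the initial sums of \<open>\<bar>y\<bar>\<close> in this order by
  those of \<open>V\<close>, so summation by parts replaces \<open>\<bar>y\<bar>\<close> by \<open>V\<close>; interchanging summation then turns the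
  bound into the Lorentz norm.
\<close>

lemma Hoelder_finite:
  assumes y: "majorized y" and B: "finite B" "B \<subseteq> {1..}"
  shows "ennreal (\<Sum>k\<in>B. \<bar>u k * y k\<bar>) \<le> lorentz_ennorm w u"
proof (cases "B = {}")
  case False
  define xs where "xs = sort_key (\<lambda>k. - \<bar>u k\<bar>) (sorted_list_of_set B)"
  have xs: "distinct xs" "set xs = B" "length xs = card B" "sorted (map (\<lambda>k. - \<bar>u k\<bar>) xs)"
    using B(1) by (auto simp: xs_def)
  obtain n where n: "card B = Suc n" using False B(1) by (metis card_eq_0_iff not0_implies_Suc)
  define c where "c i = \<bar>u (xs ! i)\<bar>" for i
  have bij: "bij_betw ((!) xs) {..<card B} B"
    by (rule bij_betw_nth[OF xs(1)]) (simp_all only: xs(2,3))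
  have inj: "inj_on ((!) xs) {..<m}" if "m \<le> card B" for m
    using bij that by (auto simp: bij_betw_def intro: inj_on_subset)
  have sub: "(!) xs ` {..<m} \<subseteq> B" if "m \<le> card B" for m
    using bij that by (auto simp: bij_betw_def)
  have dec: "c (Suc i) \<le> c i" if "i < n" for i
    using sorted_nth_mono[OF xs(4), of i "Suc i"] that n xs(3) by (simp add: c_def)
  have top: "0 \<le> (\<Sum>i<m. V i - \<bar>y (xs ! i)\<bar>)" if "m \<le> Suc n" for m
  proof -
    have m: "m \<le> card B" using that n by simp
    have "(\<Sum>i<m. \<bar>y (xs ! i)\<bar>) = (\<Sum>k\<in>(!) xs ` {..<m}. \<bar>y k\<bar>)"
      by (simp add: sum.reindex[OF inj[OF m]])
    also have "\<dots> \<le> \<Phi> (card ((!) xs ` {..<m}))"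
      by (rule majorizedD[OF y]) (use sub[OF m] B in auto)
    also have "\<dots> = \<Phi> m" by (simp add: card_image[OF inj[OF m]])
    finally show ?thesis by (simp add: sum_subtractf \<Phi>_def)
  qed
  have "0 \<le> c n * (\<Sum>i<Suc n. V i - \<bar>y (xs ! i)\<bar>)"
    using top[of "Suc n"] by (simp add: c_def del: sum.lessThan_Suc)
  also have "\<dots> \<le> (\<Sum>i<Suc n. c i * (V i - \<bar>y (xs ! i)\<bar>))"
    by (rule abel_dominated) (use top dec in auto)
  finally have le: "(\<Sum>i<Suc n. c i * \<bar>y (xs ! i)\<bar>) \<le> (\<Sum>i<Suc n. c i * V i)"
    by (simp only: right_diff_distrib sum_subtractf)
  have "(\<Sum>k\<in>B. \<bar>u k * y k\<bar>) = (\<Sum>i<card B. \<bar>u (xs ! i) * y (xs ! i)\<bar>)"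
    by (rule sum.reindex_bij_betw[OF bij, symmetric])
  also have "\<dots> = (\<Sum>i<Suc n. c i * \<bar>y (xs ! i)\<bar>)"
    unfolding n by (simp only: c_def abs_mult)
  also note le
  finally have "ennreal (\<Sum>k\<in>B. \<bar>u k * y k\<bar>) \<le> ennreal (\<Sum>i<Suc n. c i * V i)"
    by (rule ennreal_leI)
  also have "\<dots> = (\<Sum>i<Suc n. ennreal (c i) * ennreal (V i))"
    by (subst sum_ennreal[symmetric]) (simp_all only: c_def V_nonneg ennreal_mult abs_ge_zero mult_nonneg_nonneg)
  also have "\<dots> = (\<Sum>j. (\<Sum>i<min (Suc n) (Suc j). ennreal (c i)) * ennreal (q j))"
    by (rule sum_V_eq_suminf)
  also have "\<dots> \<le> lorentz_ennorm w u"
    unfolding ennorm_eq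
  proof (intro suminf_le mult_right_mono)
    fix j
    define m where "m = min (Suc n) (Suc j)"
    have m: "m \<le> card B" "m \<le> Suc j" using n by (auto simp: m_def)
    have "(\<Sum>i<m. ennreal (c i)) = ennreal (\<Sum>i<m. \<bar>u (xs ! i)\<bar>)"
      by (simp add: c_def)
    also have "(\<Sum>i<m. \<bar>u (xs ! i)\<bar>) = (\<Sum>k\<in>(!) xs ` {..<m}. \<bar>u k\<bar>)"
      by (simp add: sum.reindex[OF inj[OF m(1)]])
    also have "ennreal \<dots> \<le> (\<Sum>i<card ((!) xs ` {..<m}). rearr u (Suc i))"
      by (rule sum_abs_le_sum_rearr) (use sub[OF m(1)] B in auto)
    also have "\<dots> = (\<Sum>i<m. rearr u (Suc i))" by (simp add: card_image[OF inj[OF m(1)]])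
    also have "\<dots> \<le> (\<Sum>i<Suc j. rearr u (Suc i))" by (rule sum_mono2) (use m in auto)
    finally show "(\<Sum>i<min (Suc n) (Suc j). ennreal (c i)) \<le> (\<Sum>i<Suc j. rearr u (Suc i))"
      by (simp add: m_def)
  qed auto
  finally show ?thesis .
qed simp

lemma pairing_bound:
  assumes "majorized y" "u \<in> \<gamma>" "(\<lambda>n. u (Suc n) * y (Suc n)) sums s"
  shows "\<bar>s\<bar> \<le> lorentz_norm w u"
proof -
  have "(\<lambda>N. \<bar>\<Sum>n<N. u (Suc n) * y (Suc n)\<bar>) \<longlonglongrightarrow> \<bar>s\<bar>"
    using assms(3) unfolding sums_def by (rule tendsto_rabs)
  moreover have "\<bar>\<Sum>n<N. u (Suc n) * y (Suc n)\<bar> \<le> lorentz_norm w u" for N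
  proof -
    have "\<bar>\<Sum>n<N. u (Suc n) * y (Suc n)\<bar> \<le> (\<Sum>n<N. \<bar>u (Suc n) * y (Suc n)\<bar>)" by (rule sum_abs)
    also have "\<dots> = (\<Sum>k\<in>Suc ` {..<N}. \<bar>u k * y k\<bar>)" by (subst sum.reindex) auto
    also have "\<dots> \<le> lorentz_norm w u"
      by (subst ennreal_le_iff[OF norm_nonneg, symmetric],
          unfold ennreal_lorentz_norm[OF assms(2)], rule Hoelder_finite[OF assms(1)]) auto
    finally show ?thesis .
  qed
  ultimately show ?thesis by (intro LIMSEQ_le_const2) auto
qed

section \<open>Decreasing enumeration\<close>

text \<open>
  Infinitely many entries of modulus at least \<open>t\<close> would make \<open>\<Phi> n\<close> grow at least like \<open>n t\<close>, but its
  increments \<open>V n\<close> tend to 0.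
\<close>

lemma majorized_finite_levels:
  assumes "majorized x" "0 < t"
  shows "finite {k. 1 \<le> k \<and> t \<le> \<bar>x k\<bar>}"
proof (rule ccontr)
  assume inf: "infinite {k. 1 \<le> k \<and> t \<le> \<bar>x k\<bar>}"
  obtain N where N: "V N < t / 2" 
    using order_tendstoD(2)[OF V_tendsto_0, of "t/2"] assms(2) by (auto simp: eventually_sequentially)
  \<comment> \<open>The increments of \<open>\<Phi>\<close> eventually stay below \<open>t/2\<close>, so \<open>\<Phi> n\<close> falls below \<open>n * t\<close>.\<close>
  have grow: "\<Phi> (N + m) \<le> \<Phi> N + real m * (t / 2)" for m
  proof (induction m)
    case (Suc m)
    have "V (N + m) \<le> t / 2" using V_antimono[of N "N + m"] N by simp
    then show ?case using Suc by (simp add: \<Phi>_Suc distrib_right add_divide_distrib)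
  qed simp
  obtain m where m: "\<Phi> N < real m * (t / 2)" using reals_Archimedean3[of "t/2"] assms(2) by auto
  obtain B where B: "finite B" "card B = N + m" "B \<subseteq> {k. 1 \<le> k \<and> t \<le> \<bar>x k\<bar>}"
    using infinite_arbitrarily_large[OF inf] by blast
  have "real (N + m) * t \<le> (\<Sum>k\<in>B. \<bar>x k\<bar>)"
    using sum_bounded_below[of B t "\<lambda>k. \<bar>x k\<bar>"] B by auto
  also have "\<dots> \<le> \<Phi> (N + m)" using majorizedD[OF assms(1) B(1)] B by auto
  also have "\<dots> \<le> \<Phi> N + real m * (t / 2)" by (rule grow)
  also have "\<dots> < real m * t" using m by simp
  finally show False using assms(2) by (simp add: mult_le_cancel_right)
qed

end

text \<open>
  The enumeration need not be surjective: if \<open>x\<close> has infinitely many nonzero entries then its zeros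
  are never reached.
\<close>

definition decr_enum :: "(nat \<Rightarrow> real) \<Rightarrow> (nat \<Rightarrow> nat) \<Rightarrow> bool" where
  "decr_enum x \<sigma> \<longleftrightarrow> inj \<sigma> \<and> range \<sigma> \<subseteq> {1..} \<and>
     (\<forall>n k. 1 \<le> k \<longrightarrow> k \<notin> \<sigma> ` {..<n} \<longrightarrow> \<bar>x k\<bar> \<le> \<bar>x (\<sigma> n)\<bar>)"

text \<open>
  Greedy choice: having enumerated a finite set, take next an index of largest modulus outside it. The
  maximum exists because only finitely many entries exceed a given positive level.
\<close>

lemma exists_decr_enum:
  assumes fin: "\<And>t. 0 < t \<Longrightarrow> finite {k. 1 \<le> k \<and> t \<le> \<bar>x k\<bar>}"
  shows "\<exists>\<sigma>. decr_enum x \<sigma>"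
proof -
  define P where "P A k \<longleftrightarrow> 1 \<le> k \<and> k \<notin> A \<and> (\<forall>j. 1 \<le> j \<longrightarrow> j \<notin> A \<longrightarrow> \<bar>x j\<bar> \<le> \<bar>x k\<bar>)"
    for A :: "nat set" and k
  have ex: "\<exists>k. P A k" if "finite A" for A
  proof (cases "\<forall>j. 1 \<le> j \<longrightarrow> j \<notin> A \<longrightarrow> x j = 0")
    case True
    have "infinite ({1..} - A)" using that by (simp add: infinite_Ici)
    then obtain k where "k \<in> {1..} - A" by (metis finite.emptyI ex_in_conv)
    then show ?thesis using True by (auto simp: P_def)
  next
    case False
    then obtain j where j: "1 \<le> j" "j \<notin> A" "x j \<noteq> 0" by auto
    define L where "L = {k. 1 \<le> k \<and> \<bar>x j\<bar> \<le> \<bar>x k\<bar>} - A"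
    have L: "finite L" "L \<noteq> {}" using fin[of "\<bar>x j\<bar>"] j by (auto simp: L_def)
    define k where "k = arg_min_on (\<lambda>k. - \<bar>x k\<bar>) L"
    have k: "k \<in> L" "\<And>i. i \<in> L \<Longrightarrow> \<bar>x i\<bar> \<le> \<bar>x k\<bar>"
      using arg_min_if_finite(1)[OF L, of "\<lambda>k. - \<bar>x k\<bar>"]
        arg_min_least[OF L, of _ "\<lambda>k. - \<bar>x k\<bar>"] by (auto simp: k_def)
    have "\<bar>x i\<bar> \<le> \<bar>x k\<bar>" if "1 \<le> i" "i \<notin> A" for i
      using k that by (cases "i \<in> L") (auto simp: L_def)
    then show ?thesis using k(1) by (auto simp: P_def L_def)
  qed
  define S where "S = rec_nat {} (\<lambda>_ A. insert (SOME k. P A k) A)"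
  define \<sigma> where "\<sigma> n = (SOME k. P (S n) k)" for n
  have S: "S 0 = {}" "S (Suc n) = insert (\<sigma> n) (S n)" for n by (simp_all add: S_def \<sigma>_def)
  have S_eq: "S n = \<sigma> ` {..<n}" for n by (induction n) (auto simp: S lessThan_Suc)
  have P: "P (\<sigma> ` {..<n}) (\<sigma> n)" for n
  proof -
    have "finite (S n)" by (simp add: S_eq)
    then have "P (S n) (\<sigma> n)" unfolding \<sigma>_def by (rule someI_ex[OF ex])
    then show ?thesis by (simp only: S_eq)
  qed
  have "inj \<sigma>"
  proof (rule linorder_injI)
    fix m n :: nat assume "m < n"
    then show "\<sigma> m \<noteq> \<sigma> n" using P[of n] unfolding P_def by (metis imageI lessThan_iff)
  qed
  with P show ?thesis unfolding decr_enum_def P_def by blast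
qed

lemma decr_enum_antimono:
  assumes "decr_enum x \<sigma>" "m \<le> n"
  shows "\<bar>x (\<sigma> n)\<bar> \<le> \<bar>x (\<sigma> m)\<bar>"
proof -
  have "\<sigma> n \<notin> \<sigma> ` {..<m}" "1 \<le> \<sigma> n"
    using assms by (auto simp: decr_enum_def dest!: injD)
  then show ?thesis using assms(1) by (auto simp: decr_enum_def)
qed

lemma rearr_decr_enum:
  assumes "decr_enum x \<sigma>"
  shows "rearr x (Suc n) = ennreal \<bar>x (\<sigma> n)\<bar>"
proof (rule antisym)
  have s: "{k. 1 \<le> k \<and> \<bar>x (\<sigma> n)\<bar> < \<bar>x k\<bar>} \<subseteq> \<sigma> ` {..<n}"
  proof safe
    fix k assume k: "1 \<le> k" "\<bar>x (\<sigma> n)\<bar> < \<bar>x k\<bar>"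
    show "k \<in> \<sigma> ` {..<n}"
    proof (rule ccontr)
      assume "k \<notin> \<sigma> ` {..<n}"
      then have "\<bar>x k\<bar> \<le> \<bar>x (\<sigma> n)\<bar>" using assms k(1) unfolding decr_enum_def by blast
      then show False using k(2) by simp
    qed
  qed
  have c: "card {k. 1 \<le> k \<and> \<bar>x (\<sigma> n)\<bar> < \<bar>x k\<bar>} \<le> n"
    using card_mono[OF _ s] card_image_le[of "{..<n}" \<sigma>] by simp
  show "rearr x (Suc n) \<le> ennreal \<bar>x (\<sigma> n)\<bar>"
    by (rule rearr_le[OF abs_ge_zero finite_subset[OF s]]) (use c in simp_all)
  show "ennreal \<bar>x (\<sigma> n)\<bar> \<le> rearr x (Suc n)"
  proof (rule rearr_ge)
    show "Suc n \<le> card (\<sigma> ` {..<Suc n})"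
      by (subst card_image) (use assms in \<open>simp_all add: decr_enum_def inj_on_def\<close>)
    show "\<sigma> ` {..<Suc n} \<subseteq> {1..}" using assms by (auto simp: decr_enum_def)
  qed (use decr_enum_antimono[OF assms] in auto)
qed

lemma decr_enum_sum_le:
  assumes "decr_enum x \<sigma>" "finite B" "B \<subseteq> {1..}"
  shows "(\<Sum>k\<in>B. \<bar>x k\<bar>) \<le> (\<Sum>i<card B. \<bar>x (\<sigma> i)\<bar>)"
  using sum_abs_le_sum_rearr[OF assms(2,3), of x]
  by (simp add: rearr_decr_enum[OF assms(1)] sum_nonneg ennreal_le_iff)

context lorentz_weight
begin

section \<open>Sufficiency\<close>

text \<open>
  The second summand is \<open>W\<^sub>1(n)\<close>.
\<close>

lemma \<Phi>_eq: "\<Phi> n = (\<Sum>j<n. w (Suc j)) + real n * V n"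
proof (induction n)
  case (Suc n)
  have "real (Suc n) * q n = w (Suc n)" by (simp add: q_def)
  then show ?case using Suc V_Suc[of n] by (simp add: \<Phi>_Suc algebra_simps)
qed simp

text \<open>
  On \<open>\<sigma> ` {..<n}\<close> the sums of \<open>\<bar>y\<bar>\<close> and \<open>\<bar>z\<bar>\<close> are at most \<open>\<Phi> n\<close>, while together they are at least twice
  the sum \<open>\<Phi> n\<close> of \<open>\<bar>x\<bar>\<close>. Hence both are equal to \<open>\<Phi> n\<close> for all \<open>n\<close>, the moduli of \<open>x\<close>, \<open>y\<close>, \<open>z\<close> agree along
  \<open>\<sigma>\<close>, and the midpoint condition settles the signs. An index outside the range of \<open>\<sigma>\<close> can be added to
  any \<open>\<sigma> ` {..<n}\<close>, which leaves room for at most \<open>V n\<close>; so \<open>x\<close> and \<open>y\<close> vanish there.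
\<close>

lemma coord_eq_of_extremal:
  assumes y: "majorized y" and z: "majorized z"
    and mid: "\<And>k. 1 \<le> k \<Longrightarrow> y k + z k = 2 * x k"
    and \<sigma>: "decr_enum x \<sigma>" and x: "\<And>n. \<bar>x (\<sigma> n)\<bar> = V n"
    and k: "1 \<le> k"
  shows "y k = x k"
proof -
  have inj: "inj_on \<sigma> A" and pos: "\<sigma> ` A \<subseteq> {1..}" and pos': "1 \<le> \<sigma> i" for A i
    using \<sigma> by (auto simp: decr_enum_def intro: inj_on_subset)
  have le: "(\<Sum>i<n. \<bar>v (\<sigma> i)\<bar>) \<le> \<Phi> n" if "majorized v" for v n
    using majorizedD[OF that, of "\<sigma> ` {..<n}"] pos
    by (simp add: sum.reindex[OF inj] card_image[OF inj])
  have eq: "(\<Sum>i<n. \<bar>y (\<sigma> i)\<bar>) = \<Phi> n" "(\<Sum>i<n. \<bar>z (\<sigma> i)\<bar>) = \<Phi> n" for n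
  proof -
    have "2 * \<Phi> n = (\<Sum>i<n. 2 * \<bar>x (\<sigma> i)\<bar>)" by (simp add: \<Phi>_def x sum_distrib_left)
    also have "\<dots> \<le> (\<Sum>i<n. \<bar>y (\<sigma> i)\<bar> + \<bar>z (\<sigma> i)\<bar>)"
    proof (rule sum_mono)
      fix i show "2 * \<bar>x (\<sigma> i)\<bar> \<le> \<bar>y (\<sigma> i)\<bar> + \<bar>z (\<sigma> i)\<bar>" using mid[OF pos'[of i]] by linarith
    qed
    finally have "2 * \<Phi> n \<le> (\<Sum>i<n. \<bar>y (\<sigma> i)\<bar>) + (\<Sum>i<n. \<bar>z (\<sigma> i)\<bar>)" by (simp add: sum.distrib)
    then show "(\<Sum>i<n. \<bar>y (\<sigma> i)\<bar>) = \<Phi> n" "(\<Sum>i<n. \<bar>z (\<sigma> i)\<bar>) = \<Phi> n"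
      using le[OF y, of n] le[OF z, of n] by linarith+
  qed
  have abs: "\<bar>y (\<sigma> n)\<bar> = V n" "\<bar>z (\<sigma> n)\<bar> = V n" for n
    using eq[of "Suc n"] eq[of n] by (simp_all add: \<Phi>_Suc)
  show ?thesis
  proof (cases "k \<in> range \<sigma>")
    case True
    then obtain n where "k = \<sigma> n" by auto
    then show ?thesis using abs[of n] x[of n] mid[OF k] by (auto simp: abs_if split: if_splits)
  next
    case False
    have "\<bar>y k\<bar> \<le> V n" for n
    proof -
      have "(\<Sum>j\<in>insert k (\<sigma> ` {..<n}). \<bar>y j\<bar>) \<le> \<Phi> (card (insert k (\<sigma> ` {..<n})))"
        using pos k by (intro majorizedD[OF y]) auto
      moreover have "k \<notin> \<sigma> ` {..<n}" using False by auto
      ultimately have "\<bar>y k\<bar> + (\<Sum>i<n. \<bar>y (\<sigma> i)\<bar>) \<le> \<Phi> (Suc n)"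
        by (simp add: sum.reindex[OF inj] card_image[OF inj])
      then show ?thesis by (simp add: eq \<Phi>_Suc)
    qed
    then have "\<bar>y k\<bar> \<le> 0" by (intro LIMSEQ_le_const[OF V_tendsto_0]) auto
    moreover have "\<bar>x k\<bar> \<le> V n" for n
    proof -
      have "k \<notin> \<sigma> ` {..<n}" using False by auto
      then have "\<bar>x k\<bar> \<le> \<bar>x (\<sigma> n)\<bar>" using \<sigma> k unfolding decr_enum_def by blast
      then show ?thesis by (simp add: x)
    qed
    then have "\<bar>x k\<bar> \<le> 0" by (intro LIMSEQ_le_const[OF V_tendsto_0]) auto
    ultimately show ?thesis by simp
  qed
qed

text \<open>
  Otherwise the rearrangement of \<open>u\<close> would stay above \<open>e\<close>, and the norm would be at least \<open>e W(\<infinity>) = \<infinity>\<close>.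
\<close>

lemma finite_levels_if_divergent:
  assumes u: "u \<in> \<gamma>" and div: "\<not> summable (\<lambda>j. w (Suc j))" and "0 < e"
  shows "finite {k. 1 \<le> k \<and> e < \<bar>u k\<bar>}"
proof (rule ccontr)
  assume inf: "infinite {k. 1 \<le> k \<and> e < \<bar>u k\<bar>}"
  have ge: "ennreal e \<le> rearr u (Suc i)" for i
  proof -
    obtain B where B: "finite B" "card B = Suc i" "B \<subseteq> {k. 1 \<le> k \<and> e < \<bar>u k\<bar>}"
      using infinite_arbitrarily_large[OF inf] by blast
    show ?thesis by (rule rearr_ge[OF B(1)]) (use B in auto)
  qed
  have "(\<Sum>n. ennreal (e * w (Suc n))) \<le> lorentz_ennorm w u"
    unfolding ennorm_eq
  proof (rule suminf_le)
    fix n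
    have "(\<Sum>i<Suc n. ennreal e) \<le> (\<Sum>i<Suc n. rearr u (Suc i))" by (intro sum_mono ge)
    moreover have "(\<Sum>i<Suc n. ennreal e) = ennreal (e * real (Suc n))"
      using \<open>0 < e\<close> by (subst sum_ennreal) (auto simp: mult.commute)
    moreover have "ennreal (e * w (Suc n)) = ennreal (e * real (Suc n)) * ennreal (q n)"
      using \<open>0 < e\<close> by (simp add: ennreal_mult[symmetric] q_nonneg) (simp add: q_def)
    ultimately show "ennreal (e * w (Suc n)) \<le> (\<Sum>i<Suc n. rearr u (Suc i)) * ennreal (q n)"
      by (simp only: mult_right_mono zero_le)
  qed auto
  also have "\<dots> < top" using u by (simp add: lorentz_space_def)
  finally have "summable (\<lambda>n. e * w (Suc n))"
    using \<open>0 < e\<close> by (intro summable_suminf_not_top) (auto simp: w_nonneg)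
  then show False using div \<open>0 < e\<close> by (simp add: summable_cmult_iff)
qed

text \<open>
  Density of the finitely supported sequences when \<open>W(\<infinity>) = \<infinity>\<close>. Removing the finitely many entries of
  modulus above a small level \<open>t\<close> leaves a sequence whose rearrangement is at most \<open>t\<close> and at most
  that of \<open>u\<close>. The first bound controls the first \<open>M\<close> terms of the norm series, the second one
  its tail.
\<close>

lemma small_remainder_if_divergent:
  assumes u: "u \<in> \<gamma>" and div: "\<not> summable (\<lambda>j. w (Suc j))" and "0 < e"
  shows "\<exists>F. finite F \<and> F \<subseteq> {1..} \<and> lorentz_norm w (cut (- F) u) \<le> e"
proof -
  define a where "a n = (\<Sum>i<Suc n. rearr u (Suc i)) * ennreal (q n)" for n
  define b where "b n = enn2real (a n)" for n
  have "suminf a = lorentz_ennorm w u" unfolding a_def ennorm_eq ..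
  then have fin: "suminf a < top" using u by (simp add: lorentz_space_def)
  have a: "a n = ennreal (b n)" for n
  proof -
    have "a n \<le> suminf a" using sum_le_suminf[of a "{n}"] by simp
    then show ?thesis using fin by (simp add: b_def order.strict_trans1)
  qed
  have b: "0 \<le> b n" for n by (simp add: b_def)
  have sb: "summable b"
    using fin by (intro summable_suminf_not_top b) (simp add: a[abs_def])
  obtain M where M: "norm (\<Sum>i. b (i + M)) < e / 2"
    using suminf_exist_split[OF _ sb, of "e/2"] \<open>0 < e\<close> by auto
  define C where "C = (\<Sum>n<M. w (Suc n))"
  have C: "0 \<le> C" by (simp add: C_def sum_nonneg w_nonneg)
  \<comment> \<open>The level \<open>t\<close> makes the first \<open>M\<close> terms contribute at most \<open>e/2\<close>; adding 1 to \<open>C\<close> avoids dividing by 0.\<close>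
  define t where "t = e / (2 * (C + 1))"
  have t: "0 < t" "t * C \<le> e / 2"
    using \<open>0 < e\<close> C by (auto simp: t_def field_simps)
  define F where "F = {k. 1 \<le> k \<and> t < \<bar>u k\<bar>}"
  have F: "finite F" "F \<subseteq> {1..}"
    using finite_levels_if_divergent[OF u div t(1)] by (auto simp: F_def)
  let ?v = "cut (- F) u"
  define c where "c n = (if n < M then t * w (Suc n) else b n)" for n
  have c: "0 \<le> c n" for n using t(1) by (simp add: c_def b w_nonneg)
  have sc: "summable c"
  proof (rule summable_cong[THEN iffD1, OF _ sb])
    show "\<forall>\<^sub>F n in sequentially. b n = c n"
      unfolding eventually_sequentially by (rule exI[of _ M]) (simp add: c_def)
  qed
  have "suminf c = (\<Sum>i. c (i + M)) + (\<Sum>i<M. c i)" by (rule suminf_split_initial_segment[OF sc])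
  also have "(\<Sum>i. c (i + M)) = (\<Sum>i. b (i + M))" by (simp add: c_def)
  also have "(\<Sum>i<M. c i) = t * C" by (simp add: c_def C_def sum_distrib_left)
  finally have le: "suminf c \<le> e" using M t(2) by simp
  have "lorentz_ennorm w ?v \<le> (\<Sum>n. ennreal (c n))"
    unfolding ennorm_eq
  proof (rule suminf_le)
    fix n
    show "(\<Sum>i<Suc n. rearr ?v (Suc i)) * ennreal (q n) \<le> ennreal (c n)"
    proof (cases "n < M")
      case True
      have "(\<Sum>i<Suc n. rearr ?v (Suc i)) \<le> (\<Sum>i<Suc n. ennreal t)"
        using t(1) by (intro sum_mono rearr_le_bound) (auto simp: cut_def F_def)
      also have "\<dots> = ennreal (t * real (Suc n))"
        using t(1) by (subst sum_ennreal) (auto simp: mult.commute)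
      finally have "(\<Sum>i<Suc n. rearr ?v (Suc i)) * ennreal (q n) \<le> ennreal (t * real (Suc n)) * ennreal (q n)"
        by (rule mult_right_mono) simp
      also have "\<dots> = ennreal (c n)"
        using t(1) True by (simp add: c_def ennreal_mult[symmetric] q_nonneg) (simp add: q_def)
      finally show ?thesis .
    next
      case False
      have "(\<Sum>i<Suc n. rearr ?v (Suc i)) * ennreal (q n) \<le> a n"
        unfolding a_def by (intro mult_right_mono sum_mono rearr_mono) (auto simp: cut_def)
      then show ?thesis using False by (simp add: a c_def)
    qed
  qed auto
  also have "\<dots> = ennreal (suminf c)" by (rule suminf_ennreal2[OF c sc])
  also have "\<dots> \<le> ennreal e" using le by (rule ennreal_leI)
  finally have "lorentz_norm w ?v \<le> e"
    by (rule in_space_norm_le(2)[rotated]) (use u \<open>0 < e\<close> in \<open>auto simp: cut_def space_0\<close>)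
  then show ?thesis using F by blast
qed

lemma space_bounded:
  assumes "u \<in> \<gamma>"
  obtains c where "0 \<le> c" "\<And>k. 1 \<le> k \<Longrightarrow> \<bar>u k\<bar> \<le> c"
proof -
  obtain n where n: "1 \<le> n" "0 < w n" using weight by (auto simp: nonneg_weight_def)
  then obtain j where "n = Suc j" by (cases n) auto
  with n have j: "0 < q j" by (simp add: q_def)
  have "rearr u (Suc 0) * ennreal (q j) \<le> (\<Sum>i<Suc j. rearr u (Suc i)) * ennreal (q j)"
    by (intro mult_right_mono member_le_sum) auto
  also have "\<dots> \<le> lorentz_ennorm w u"
    unfolding ennorm_eq using sum_le_suminf[of "\<lambda>n. (\<Sum>i<Suc n. rearr u (Suc i)) * ennreal (q n)" "{j}"] by simp
  also have "\<dots> < top" using assms by (simp add: lorentz_space_def)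
  finally have "rearr u (Suc 0) < top" using j by (auto simp: ennreal_mult_less_top)
  then obtain l where l: "0 \<le> l" "distr_fun u l \<le> 0"
    by (auto simp: rearr_def INF_less_iff zero_enat_def)
  then have "{k. 1 \<le> k \<and> l < \<bar>u k\<bar>} = {}"
    by (auto simp: distr_fun_def zero_enat_def split: if_splits)
  then have "\<bar>u k\<bar> \<le> l" if "1 \<le> k" for k using that by force
  with l(1) show thesis by (rule that)
qed

lemma dual_split:
  assumes "g \<in> lorentz_dual w" "u \<in> \<gamma>"
  shows "g u = g (cut F u) + g (cut (- F) u)"
proof -
  have "u = (\<lambda>k. cut F u k + cut (- F) u k)" by (auto simp: cut_def)
  then show ?thesis using dual_add[OF assms(1) cut_in_space cut_in_space, OF assms(2) assms(2)] by metis
qed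

lemma partial_pairing:
  assumes "represents w x f" "u \<in> \<gamma>"
  shows "(\<lambda>N. \<Sum>k\<in>{1..N}. u k * x k) \<longlonglongrightarrow> f u"
proof -
  have "(\<Sum>k\<in>{1..N}. u k * x k) = (\<Sum>n<N. u (Suc n) * x (Suc n))" for N
    by (rule sum.reindex_bij_witness[of _ Suc "\<lambda>k. k - 1"]) auto
  then show ?thesis using assms by (simp add: represents_def sums_def)
qed

text \<open>
  The test sequence equals \<open>c sgn x\<close> on \<open>{1..N}\<close> and \<open>u\<close> beyond, where \<open>c\<close> bounds \<open>\<bar>u\<bar>\<close>; its norm is at most
  \<open>c W(\<infinity>)\<close>. The initial part contributes \<open>c \<Sum>\<^sub>k\<^sub>\<le>\<^sub>N \<bar>x k\<bar>\<close>, which tends to at least \<open>c W(\<infinity>)\<close>, and the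
  rest contributes \<open>g u - \<Sum>\<^sub>k\<^sub>\<le>\<^sub>N u k * x k\<close>, which tends to \<open>g u - f u\<close>. So this
  difference, the value of the singular part of \<open>g\<close> at \<open>u\<close>, is at most 0.
\<close>

lemma functional_le_if_summable:
  assumes sw: "summable (\<lambda>j. w (Suc j))"
    and g: "g \<in> lorentz_dual w" "dual_norm w g \<le> 1" "coord g = x"
    and f: "represents w x f"
    and \<sigma>: "decr_enum x \<sigma>" and x: "\<And>n. \<bar>x (\<sigma> n)\<bar> = V n"
    and u: "u \<in> \<gamma>"
  shows "g u \<le> f u"
proof -
  obtain c where c: "0 \<le> c" "\<And>k. 1 \<le> k \<Longrightarrow> \<bar>u k\<bar> \<le> c" using space_bounded[OF u] by blast
  let ?W = "\<Sum>j. w (Suc j)"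
  have N: "c * (\<Sum>k\<in>{1..N}. \<bar>x k\<bar>) + g u - (\<Sum>k\<in>{1..N}. u k * x k) \<le> c * ?W" for N
  proof -
    let ?a = "cut {1..N} (\<lambda>k. c * sgn (x k))" and ?b = "cut (- {1..N}) u"
    let ?v = "\<lambda>k. ?a k + ?b k"
    have ab: "?a \<in> \<gamma>" "?b \<in> \<gamma>" by (rule cut_finite_in_space; simp) (rule cut_in_space[OF u])
    have "lorentz_ennorm w ?v \<le> ennreal (c * ?W)"
      by (rule ennorm_bounded[OF sw c(1)]) (use c in \<open>auto simp: cut_def abs_mult abs_sgn_eq\<close>)
    then have v: "lorentz_norm w ?v \<le> c * ?W" "?v \<in> \<gamma>"
      using c(1) sw by (auto intro!: in_space_norm_le simp: suminf_nonneg w_nonneg space_0[OF u] cut_def)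
    have "g ?v \<le> dual_norm w g * lorentz_norm w ?v" using dual_bound[OF g(1) v(2)] by simp
    also have "\<dots> \<le> 1 * lorentz_norm w ?v" by (rule mult_right_mono[OF g(2) norm_nonneg])
    finally have "g ?v \<le> c * ?W" using v(1) by simp
    moreover have "g ?v = g ?a + g ?b" by (rule dual_add[OF g(1) ab])
    moreover have "g ?a = c * (\<Sum>k\<in>{1..N}. \<bar>x k\<bar>)"
      by (subst dual_finite_sum[OF g(1)])
        (auto simp: g(3) sum_distrib_left mult.assoc linordered_idom_class.abs_sgn intro!: sum.cong)
    moreover have "g ?b = g u - g (cut {1..N} u)" using dual_split[OF g(1) u, of "{1..N}"] by simp
    moreover have "g (cut {1..N} u) = (\<Sum>k\<in>{1..N}. u k * x k)"
      by (subst dual_finite_sum[OF g(1)]) (auto simp: g(3))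
    ultimately show ?thesis by simp
  qed
  have M: "c * (\<Sum>j<M. w (Suc j)) + g u - f u \<le> c * ?W" for M
  proof (rule LIMSEQ_le_const2)
    show "(\<lambda>N. c * (\<Sum>j<M. w (Suc j)) + g u - (\<Sum>k\<in>{1..N}. u k * x k)) \<longlonglongrightarrow> c * (\<Sum>j<M. w (Suc j)) + g u - f u"
      by (intro tendsto_intros partial_pairing[OF f u])
    \<comment> \<open>From \<open>N0\<close> on, \<open>{1..N}\<close> contains the \<open>M\<close> largest entries of \<open>x\<close>, whose sum \<open>\<Phi> M\<close> is at least \<open>W(M)\<close>.\<close>
    define N0 where "N0 = Max (insert 0 (\<sigma> ` {..<M}))"
    have "c * (\<Sum>j<M. w (Suc j)) + g u - (\<Sum>k\<in>{1..N}. u k * x k) \<le> c * ?W" if "N0 \<le> N" for N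
    proof -
      have "(\<Sum>j<M. w (Suc j)) \<le> \<Phi> M" by (simp add: \<Phi>_eq V_nonneg)
      also have "\<dots> = (\<Sum>k\<in>\<sigma> ` {..<M}. \<bar>x k\<bar>)"
        by (subst sum.reindex) (use \<sigma> in \<open>auto simp: \<Phi>_def x decr_enum_def intro: inj_on_subset\<close>)
      also have "\<dots> \<le> (\<Sum>k\<in>{1..N}. \<bar>x k\<bar>)"
      proof (rule sum_mono2)
        have "k \<le> N0" if "k \<in> \<sigma> ` {..<M}" for k unfolding N0_def using that by (intro Max_ge) auto
        then show "\<sigma> ` {..<M} \<subseteq> {1..N}" using \<sigma> that unfolding decr_enum_def by fastforce
      qed auto
      finally have "c * (\<Sum>j<M. w (Suc j)) \<le> c * (\<Sum>k\<in>{1..N}. \<bar>x k\<bar>)" using c(1) by (rule mult_left_mono)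
      then show ?thesis using N[of N] by simp
    qed
    then show "\<exists>N0. \<forall>N\<ge>N0. c * (\<Sum>j<M. w (Suc j)) + g u - (\<Sum>k\<in>{1..N}. u k * x k) \<le> c * ?W" by blast
  qed
  have "(\<lambda>M. c * (\<Sum>j<M. w (Suc j)) + g u - f u) \<longlonglongrightarrow> c * ?W + g u - f u"
    by (intro tendsto_intros summable_LIMSEQ[OF sw])
  then have "c * ?W + g u - f u \<le> c * ?W" by (rule LIMSEQ_le_const2) (use M in auto)
  then show ?thesis by simp
qed

text \<open>
  The difference of \<open>g\<close> and \<open>f\<close> vanishes on finitely supported sequences. For a summable weight
  \<open>functional_le_if_summable\<close> at \<open>u\<close> and \<open>- u\<close> shows that it is 0; otherwise density does.
\<close>

lemma functional_eq_of_coord: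
  assumes g: "g \<in> lorentz_dual w" "dual_norm w g \<le> 1" "coord g = x"
    and f: "f \<in> lorentz_dual w" "represents w x f"
    and \<sigma>: "decr_enum x \<sigma>" and x: "\<And>n. \<bar>x (\<sigma> n)\<bar> = V n"
    and u: "u \<in> \<gamma>"
  shows "g u = f u"
proof (cases "summable (\<lambda>j. w (Suc j))")
  case True
  have "g u \<le> f u" by (rule functional_le_if_summable[OF True g f(2) \<sigma> x u])
  moreover have "g (\<lambda>k. (- 1) * u k) \<le> f (\<lambda>k. (- 1) * u k)"
    by (rule functional_le_if_summable[OF True g f(2) \<sigma> x space_scale(1)[OF u]])
  then have "f u \<le> g u" unfolding dual_scale[OF g(1) u] dual_scale[OF f(1) u] by simp
  ultimately show ?thesis by simp
next
  case False
  let ?C = "dual_norm w f + dual_norm w g"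
  have small: "\<bar>g u - f u\<bar> \<le> \<bar>?C\<bar> * e" if "0 < e" for e
  proof -
    obtain F where F: "finite F" "F \<subseteq> {1..}" "lorentz_norm w (cut (- F) u) \<le> e"
      using small_remainder_if_divergent[OF u False \<open>0 < e\<close>] by blast
    let ?v = "cut (- F) u"
    have v: "?v \<in> \<gamma>" by (rule cut_in_space[OF u])
    have "g (cut F u) = f (cut F u)"
      by (simp add: dual_finite_sum[OF g(1) F(1,2)] dual_finite_sum[OF f(1) F(1,2)] g(3) represents_coord[OF f(2)])
    then have "\<bar>g u - f u\<bar> = \<bar>g ?v - f ?v\<bar>"
      by (simp add: dual_split[OF g(1) u, of F] dual_split[OF f(1) u, of F])
    also have "\<dots> \<le> ?C * lorentz_norm w ?v"
      using dual_bound[OF g(1) v] dual_bound[OF f(1) v] by (simp add: distrib_right)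
    also have "\<dots> \<le> \<bar>?C\<bar> * e"
      using F(3) norm_nonneg by (intro mult_mono) auto
    finally show ?thesis .
  qed
  have "\<bar>g u - f u\<bar> \<le> 0"
  proof (rule field_le_epsilon)
    fix e :: real assume "0 < e"
    have "\<bar>?C\<bar> * (e / (\<bar>?C\<bar> + 1)) \<le> e" using \<open>0 < e\<close> by (simp add: field_simps)
    then show "\<bar>g u - f u\<bar> \<le> 0 + e" using small[of "e / (\<bar>?C\<bar> + 1)"] \<open>0 < e\<close> by simp
  qed
  then show ?thesis by simp
qed

lemma extreme_if_enum_eq:
  assumes f: "f \<in> dual_sphere w" "represents w x f"
    and \<sigma>: "decr_enum x \<sigma>" and x: "\<And>n. \<bar>x (\<sigma> n)\<bar> = V n"
  shows "dual_ball_extreme w f"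
  unfolding dual_ball_extreme_def
proof (intro conjI ballI impI)
  fix g h
  assume g: "g \<in> dual_sphere w" and h: "h \<in> dual_sphere w"
    and mid: "\<forall>u\<in>\<gamma>. f u = (g u + h u) / 2"
  have f': "f \<in> lorentz_dual w" and g': "g \<in> lorentz_dual w" "dual_norm w g \<le> 1"
    and h': "h \<in> lorentz_dual w" "dual_norm w h \<le> 1"
    using f g h by (auto simp: dual_sphere_def)
  have xc: "coord f = x" by (rule represents_coord[OF f(2)])
  have sum: "coord g k + coord h k = 2 * x k" if "1 \<le> k" for k
    using mid indicator_in_space[OF that] that by (auto simp: xc[symmetric] coord_def)
  have "coord g k = x k" for k
    using coord_eq_of_extremal[OF coord_majorized[OF g'] coord_majorized[OF h'] sum \<sigma> x, of k] xc
    by (cases "k = 0") (auto simp: coord_def)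
  then have "coord g = x" ..
  then have gu: "g u = f u" if "u \<in> \<gamma>" for u
    using functional_eq_of_coord[OF g' _ f' f(2) \<sigma> x that] by blast
  have hu: "h u = f u" if "u \<in> \<gamma>" for u
    using gu[OF that] mid that by force
  have ext: "f \<in> extensional \<gamma>" "g \<in> extensional \<gamma>" "h \<in> extensional \<gamma>"
    using f' g' h' by (auto simp: lorentz_dual_def)
  show "f = g" by (rule extensionalityI[OF ext(1,2)]) (simp add: gu)
  show "g = h" by (rule extensionalityI[OF ext(2,3)]) (simp add: gu hu)
qed (fact f)

section \<open>Necessity\<close>

lemma perturbed_functional:
  fixes d :: "nat \<Rightarrow> real"
  assumes f: "f \<in> lorentz_dual w" "represents w x f"
    and d: "\<And>k. N < k \<Longrightarrow> d k = 0" and m: "majorized (\<lambda>k. x k + d k)"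
  defines "g \<equiv> restrict (\<lambda>u. f u + (\<Sum>n<N. u (Suc n) * d (Suc n))) \<gamma>"
  shows "g \<in> lorentz_dual w" "dual_norm w g \<le> 1"
proof -
  have g: "g u = f u + (\<Sum>n<N. u (Suc n) * d (Suc n))" if "u \<in> \<gamma>" for u
    using that by (simp add: g_def)
  have bound: "\<bar>g u\<bar> \<le> 1 * lorentz_norm w u" if u: "u \<in> \<gamma>" for u
  proof -
    have "(\<lambda>n. u (Suc n) * x (Suc n)) sums f u" using f(2) u by (simp add: represents_def)
    moreover have "(\<lambda>n. u (Suc n) * d (Suc n)) sums (\<Sum>n<N. u (Suc n) * d (Suc n))"
      by (rule sums_finite) (use d in auto)
    ultimately have "(\<lambda>n. u (Suc n) * (x (Suc n) + d (Suc n))) sums g u"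
      unfolding g[OF u] distrib_left by (rule sums_add)
    from pairing_bound[OF m u this] show ?thesis by simp
  qed
  show "dual_norm w g \<le> 1" by (rule dual_norm_le[OF bound]) auto
  show "g \<in> lorentz_dual w"
    unfolding lorentz_dual_def
  proof (intro CollectI conjI ballI allI)
    show "g \<in> extensional \<gamma>" by (simp add: g_def)
    show "g (\<lambda>n. u n + v n) = g u + g v" if "u \<in> \<gamma>" "v \<in> \<gamma>" for u v
      by (simp add: g that space_add dual_add[OF f(1)] distrib_right sum.distrib)
    show "g (\<lambda>n. c * u n) = c * g u" if "u \<in> \<gamma>" for c u
      by (simp add: g that space_scale dual_scale[OF f(1)] distrib_left sum_distrib_left mult.assoc)
    show "\<exists>C. \<forall>u\<in>\<gamma>. \<bar>g u\<bar> \<le> C * lorentz_norm w u" using bound by blast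
  qed
qed

text \<open>
  The functionals with coordinates \<open>x + d\<close> and \<open>x - d\<close> have norm at most 1 and midpoint \<open>f\<close>, which has
  norm 1, so both lie on the sphere.
\<close>

lemma not_extreme_if_perturbation:
  fixes d :: "nat \<Rightarrow> real"
  assumes f: "f \<in> dual_sphere w" "represents w x f"
    and d: "\<And>k. N < k \<Longrightarrow> d k = 0" "1 \<le> j" "d j \<noteq> 0"
    and m: "majorized (\<lambda>k. x k + d k)" "majorized (\<lambda>k. x k - d k)"
  shows "\<not> dual_ball_extreme w f"
proof
  assume ex: "dual_ball_extreme w f"
  have f': "f \<in> lorentz_dual w" "dual_norm w f = 1" using f(1) by (auto simp: dual_sphere_def)
  define g where "g = restrict (\<lambda>u. f u + (\<Sum>n<N. u (Suc n) * d (Suc n))) \<gamma>"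
  define h where "h = restrict (\<lambda>u. f u + (\<Sum>n<N. u (Suc n) * (- d (Suc n)))) \<gamma>"
  have g: "g \<in> lorentz_dual w" "dual_norm w g \<le> 1"
    unfolding g_def using perturbed_functional[OF f'(1) f(2) d(1) m(1)] by simp_all
  have h: "h \<in> lorentz_dual w" "dual_norm w h \<le> 1"
    unfolding h_def using perturbed_functional[OF f'(1) f(2), of N "\<lambda>k. - d k"] d(1) m(2) by simp_all
  have mid: "f u = (g u + h u) / 2" if "u \<in> \<gamma>" for u
    using that by (simp add: g_def h_def sum_negf)
  have "\<bar>f u\<bar> \<le> (dual_norm w g + dual_norm w h) / 2 * lorentz_norm w u" if u: "u \<in> \<gamma>" for u
    using mid[OF u] dual_bound[OF g(1) u] dual_bound[OF h(1) u] by (simp add: distrib_right)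
  moreover have "0 \<le> dual_norm w k" if "k \<in> lorentz_dual w" for k
  proof -
    have "cut {} (\<lambda>_. 0) \<in> \<gamma>" "lorentz_norm w (cut {} (\<lambda>_. 0)) \<le> 0"
      using cut_finite[of "{}" 0 "\<lambda>_. 0"] by simp_all
    then have "\<bar>k (cut {} (\<lambda>_. 0))\<bar> \<le> dual_norm w k"
      unfolding dual_norm_def by (intro cSUP_upper dual_bdd[OF that]) auto
    then show ?thesis by linarith
  qed
  ultimately have "1 \<le> (dual_norm w g + dual_norm w h) / 2"
    using dual_norm_le[of f "(dual_norm w g + dual_norm w h) / 2"] g(1) h(1) f'(2) by simp
  then have "g \<in> dual_sphere w" "h \<in> dual_sphere w" using g h by (auto simp: dual_sphere_def)
  then have "f = g" using ex mid unfolding dual_ball_extreme_def by blast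
  then have "f (indicator {j}) = g (indicator {j})" by simp
  moreover have "g (indicator {j}) = f (indicator {j}) + d j"
  proof -
    have "\<not> N < j" using d(1)[of j] d(3) by blast
    then obtain i where i: "j = Suc i" "i < N" using d(2) by (cases j) auto
    have "(\<Sum>n<N. indicator {j} (Suc n) * d (Suc n)) = (\<Sum>n<N. if n = i then d (Suc n) else 0)"
      by (rule sum.cong) (auto simp: i(1) indicator_def)
    then show ?thesis using indicator_in_space[OF d(2)] i by (simp add: g_def)
  qed
  ultimately show False using d(3) by simp
qed

text \<open>
  Majorization applied to \<open>B\<close> with \<open>k\<close> exchanged for \<open>l\<close>: if \<open>B\<close> contains a small entry while it misses a
  large one, then the bound for \<open>B\<close> is not tight.
\<close>

lemma majorized_exchange:
  assumes "majorized x" "finite B" "B \<subseteq> {1..}" "k \<in> B" "l \<notin> B" "1 \<le> l"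
  shows "(\<Sum>i\<in>B. \<bar>x i\<bar>) + \<bar>x l\<bar> \<le> \<Phi> (card B) + \<bar>x k\<bar>"
proof -
  have l: "l \<notin> B - {k}" "finite (B - {k})" using assms by auto
  have "(\<Sum>i\<in>insert l (B - {k}). \<bar>x i\<bar>) \<le> \<Phi> (card (insert l (B - {k})))"
    by (rule majorizedD[OF assms(1)]) (use assms in auto)
  moreover have "card (insert l (B - {k})) = card B"
    unfolding card_insert_disjoint[OF l(2,1)] by (rule card_Suc_Diff1[OF assms(2,4)])
  moreover have "(\<Sum>i\<in>insert l (B - {k}). \<bar>x i\<bar>) = \<bar>x l\<bar> + (\<Sum>i\<in>B - {k}. \<bar>x i\<bar>)"
    by (rule sum.insert[OF l(2,1)])
  moreover have "(\<Sum>i\<in>B. \<bar>x i\<bar>) = \<bar>x k\<bar> + (\<Sum>i\<in>B - {k}. \<bar>x i\<bar>)"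
    by (rule sum.remove[OF assms(2,4)])
  ultimately show ?thesis by simp
qed

text \<open>
  \<open>B\<close> contains an index other than the first \<open>p\<close> of the enumeration and, having at most \<open>p\<close> elements,
  it misses one of these. Exchanging them gains the drop of \<open>\<bar>x \<circ> \<sigma>\<bar>\<close> at \<open>p\<close>.
\<close>

lemma slack_below:
  assumes x: "majorized x" and \<sigma>: "decr_enum x \<sigma>"
    and B: "finite B" "B \<subseteq> {1..}" "k \<in> B" "k \<notin> \<sigma> ` {..<p}" "card B \<le> p"
    and \<delta>: "0 < p \<Longrightarrow> \<delta> \<le> \<bar>x (\<sigma> (p - 1))\<bar> - \<bar>x (\<sigma> p)\<bar>"
  shows "(\<Sum>i\<in>B. \<bar>x i\<bar>) + \<delta> \<le> \<Phi> (card B)"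
proof -
  have p: "0 < p" using B card_gt_0_iff[of B] by auto
  have inj: "inj_on \<sigma> {..<p}" using \<sigma> by (auto simp: decr_enum_def intro: inj_on_subset)
  have "\<not> \<sigma> ` {..<p} \<subseteq> B"
  proof
    assume "\<sigma> ` {..<p} \<subseteq> B"
    then have "insert k (\<sigma> ` {..<p}) \<subseteq> B" using B by auto
    from card_mono[OF B(1) this] show False using B(4,5) by (simp add: card_image[OF inj])
  qed
  then obtain i where i: "i < p" "\<sigma> i \<notin> B" by auto
  have k: "\<bar>x k\<bar> \<le> \<bar>x (\<sigma> p)\<bar>" using \<sigma> B unfolding decr_enum_def by auto
  have "\<bar>x (\<sigma> (p - 1))\<bar> \<le> \<bar>x (\<sigma> i)\<bar>" by (rule decr_enum_antimono[OF \<sigma>]) (use i in auto)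
  moreover have "1 \<le> \<sigma> i" using \<sigma> by (auto simp: decr_enum_def)
  ultimately show ?thesis
    using majorized_exchange[OF x B(1,2,3) i(2)] k \<delta>[OF p] by linarith
qed

text \<open>
  \<open>B\<close> misses one of the first \<open>r\<close> indices and, having at least \<open>r\<close> elements, it contains one
  outside these. Exchanging them gains the drop of \<open>\<bar>x \<circ> \<sigma>\<bar>\<close> at \<open>r\<close>.
\<close>

lemma slack_above:
  assumes x: "majorized x" and \<sigma>: "decr_enum x \<sigma>"
    and B: "finite B" "B \<subseteq> {1..}" "l \<notin> B" "l \<in> \<sigma> ` {..<r}" "r \<le> card B"
    and \<delta>: "\<delta> \<le> \<bar>x (\<sigma> (r - 1))\<bar> - \<bar>x (\<sigma> r)\<bar>"
  shows "(\<Sum>i\<in>B. \<bar>x i\<bar>) + \<delta> \<le> \<Phi> (card B)"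
proof -
  have inj: "inj_on \<sigma> {..<r}" using \<sigma> by (auto simp: decr_enum_def intro: inj_on_subset)
  have "\<not> B \<subseteq> \<sigma> ` {..<r}"
  proof
    assume "B \<subseteq> \<sigma> ` {..<r}"
    then have "B \<subset> \<sigma> ` {..<r}" using B by blast
    then have "card B < r" using psubset_card_mono[of "\<sigma> ` {..<r}" B] by (simp add: card_image[OF inj])
    then show False using B(5) by simp
  qed
  then obtain k where k: "k \<in> B" "k \<notin> \<sigma> ` {..<r}" by auto
  have "1 \<le> k" using k B by auto
  then have "\<bar>x k\<bar> \<le> \<bar>x (\<sigma> r)\<bar>" using \<sigma> k unfolding decr_enum_def by auto
  moreover obtain i where i: "l = \<sigma> i" "i < r" using B by auto
  have "\<bar>x (\<sigma> (r - 1))\<bar> \<le> \<bar>x l\<bar>" unfolding i(1) by (rule decr_enum_antimono[OF \<sigma>]) (use i in auto)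
  moreover have "1 \<le> l" using \<sigma> i by (auto simp: decr_enum_def)
  ultimately show ?thesis
    using majorized_exchange[OF x B(1,2) k(1) B(3)] \<delta> by linarith
qed

text \<open>
  Moving \<open>\<delta>\<close> from position \<open>i2\<close> to \<open>i1\<close> increases the sum over \<open>B\<close> only if \<open>B\<close> contains \<open>\<sigma> i1\<close> and not
  \<open>\<sigma> i2\<close>. Then there is slack \<open>\<delta>\<close>: from the drop at \<open>p\<close> if \<open>card B \<le> p\<close>, from the drop at \<open>r\<close> if
  \<open>card B \<ge> r\<close>, and from \<open>\<Phi>\<close> exceeding the largest sums of \<open>\<bar>x\<bar>\<close> for cardinalities in between.
\<close>

lemma majorized_transfer:
  assumes x: "majorized x" and \<sigma>: "decr_enum x \<sigma>"
    and pr: "p \<le> i1" "i1 < r" "p \<le> i2" "i2 < r" "i1 \<noteq> i2"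
    and gap: "0 < p \<Longrightarrow> \<delta> \<le> \<bar>x (\<sigma> (p - 1))\<bar> - \<bar>x (\<sigma> p)\<bar>" "\<delta> \<le> \<bar>x (\<sigma> (r - 1))\<bar> - \<bar>x (\<sigma> r)\<bar>"
    and mid: "\<And>n. p < n \<Longrightarrow> n < r \<Longrightarrow> (\<Sum>i<n. \<bar>x (\<sigma> i)\<bar>) + \<delta> \<le> \<Phi> n"
    and y: "\<bar>y (\<sigma> i1)\<bar> = \<bar>x (\<sigma> i1)\<bar> + \<delta>" "\<bar>y (\<sigma> i2)\<bar> = \<bar>x (\<sigma> i2)\<bar> - \<delta>"
      "\<And>k. k \<noteq> \<sigma> i1 \<Longrightarrow> k \<noteq> \<sigma> i2 \<Longrightarrow> \<bar>y k\<bar> = \<bar>x k\<bar>" and "0 \<le> \<delta>"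
  shows "majorized y"
  unfolding majorized_def
proof (intro allI impI)
  fix B :: "nat set" assume B: "finite B" "B \<subseteq> {1..}"
  have inj: "inj \<sigma>" using \<sigma> by (simp add: decr_enum_def)
  have ne: "\<sigma> i1 \<noteq> \<sigma> i2" using pr by (simp add: inj_eq[OF inj])
  have "(\<Sum>k\<in>B. \<bar>y k\<bar>) = (\<Sum>k\<in>B. \<bar>x k\<bar> + ((if k = \<sigma> i1 then \<delta> else 0) - (if k = \<sigma> i2 then \<delta> else 0)))"
    by (rule sum.cong) (use y ne in auto)
  also have "\<dots> = (\<Sum>k\<in>B. \<bar>x k\<bar>) + ((if \<sigma> i1 \<in> B then \<delta> else 0) - (if \<sigma> i2 \<in> B then \<delta> else 0))"
    using B(1) by (simp add: sum.distrib sum_subtractf)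
  also have "\<dots> \<le> \<Phi> (card B)"
  proof (cases "\<sigma> i1 \<in> B \<and> \<sigma> i2 \<notin> B")
    case True
    consider "card B \<le> p" | "p < card B" "card B < r" | "r \<le> card B" by linarith
    then have "(\<Sum>k\<in>B. \<bar>x k\<bar>) + \<delta> \<le> \<Phi> (card B)"
    proof cases
      case 1
      have "\<sigma> i1 \<notin> \<sigma> ` {..<p}" using pr by (simp add: inj_image_mem_iff[OF inj])
      then show ?thesis using slack_below[OF x \<sigma> B, of "\<sigma> i1" p \<delta>] True 1 gap(1) by blast
    next
      case 2
      then show ?thesis using decr_enum_sum_le[OF \<sigma> B] mid[OF 2] by linarith
    next
      case 3
      have "\<sigma> i2 \<in> \<sigma> ` {..<r}" using pr by auto
      then show ?thesis using slack_above[OF x \<sigma> B, of "\<sigma> i2" r \<delta>] True 3 gap(2) by blast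
    qed
    then show ?thesis using True by simp
  next
    case False
    then show ?thesis using majorizedD[OF x B] \<open>0 \<le> \<delta>\<close> by auto
  qed
  finally show "(\<Sum>k\<in>B. \<bar>y k\<bar>) \<le> \<Phi> (card B)" .
qed

text \<open>
  The counterpart of \<open>majorized_transfer\<close> without an upper end: if the slack in \<open>\<Phi>\<close> is at least \<open>\<delta>\<close> for
  all cardinalities above \<open>p\<close>, the entry at position \<open>p\<close> may grow on its own.
\<close>

lemma majorized_bump:
  assumes x: "majorized x" and \<sigma>: "decr_enum x \<sigma>"
    and gap: "0 < p \<Longrightarrow> \<delta> \<le> \<bar>x (\<sigma> (p - 1))\<bar> - \<bar>x (\<sigma> p)\<bar>"
    and mid: "\<And>n. p < n \<Longrightarrow> (\<Sum>i<n. \<bar>x (\<sigma> i)\<bar>) + \<delta> \<le> \<Phi> n"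
    and y: "\<bar>y (\<sigma> p)\<bar> \<le> \<bar>x (\<sigma> p)\<bar> + \<delta>" "\<And>k. k \<noteq> \<sigma> p \<Longrightarrow> \<bar>y k\<bar> = \<bar>x k\<bar>"
  shows "majorized y"
  unfolding majorized_def
proof (intro allI impI)
  fix B :: "nat set" assume B: "finite B" "B \<subseteq> {1..}"
  have inj: "inj \<sigma>" using \<sigma> by (simp add: decr_enum_def)
  have "(\<Sum>k\<in>B. \<bar>y k\<bar>) \<le> (\<Sum>k\<in>B. \<bar>x k\<bar> + (if k = \<sigma> p then \<delta> else 0))"
    by (rule sum_mono) (use y in auto)
  also have "\<dots> = (\<Sum>k\<in>B. \<bar>x k\<bar>) + (if \<sigma> p \<in> B then \<delta> else 0)"
    using B(1) by (simp add: sum.distrib)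
  also have "\<dots> \<le> \<Phi> (card B)"
  proof (cases "\<sigma> p \<in> B")
    case True
    have "(\<Sum>k\<in>B. \<bar>x k\<bar>) + \<delta> \<le> \<Phi> (card B)"
    proof (cases "card B \<le> p")
      case 1: True
      have "\<sigma> p \<notin> \<sigma> ` {..<p}" by (simp add: inj_image_mem_iff[OF inj])
      then show ?thesis using slack_below[OF x \<sigma> B, of "\<sigma> p" p \<delta>] True 1 gap by blast
    next
      case False
      then show ?thesis using decr_enum_sum_le[OF \<sigma> B] mid[of "card B"] by linarith
    qed
    then show ?thesis using True by simp
  next
    case False
    then show ?thesis using majorizedD[OF x B] by auto
  qed
  finally show "(\<Sum>k\<in>B. \<bar>y k\<bar>) \<le> \<Phi> (card B)" .
qed

text \<open>
  Let \<open>p\<close> be the largest number such that there is no slack up to \<open>p\<close>. The sequence \<open>\<bar>x \<circ> \<sigma>\<bar>\<close> drops strictly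
  at \<open>p\<close> (if \<open>p > 0\<close>), because it agrees with \<open>V\<close> before and is smaller than \<open>V\<close> at \<open>p\<close>. If the slack
  vanishes again, then at the first such \<open>r\<close> there is a strict drop too, for the opposite reason, and a
  transfer between \<open>p\<close> and \<open>r - 1\<close> is possible. If it never vanishes, any later strict drop serves as \<open>r\<close>; and if there
  is none, the null sequence \<open>\<bar>x \<circ> \<sigma>\<bar>\<close> is 0 after \<open>p\<close>, the slack does not decrease from there on, and the
  entry at \<open>p\<close> can be changed alone.
\<close>

lemma exists_perturbation:
  assumes x: "majorized x" and \<sigma>: "decr_enum x \<sigma>" and ne: "\<bar>x (\<sigma> n0)\<bar> \<noteq> V n0"
  obtains d :: "nat \<Rightarrow> real" and N j where "\<And>k. N < k \<Longrightarrow> d k = 0" "1 \<le> j" "d j \<noteq> 0"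
    "majorized (\<lambda>k. x k + d k)" "majorized (\<lambda>k. x k - d k)"
proof -
  define a where "a n = \<bar>x (\<sigma> n)\<bar>" for n
  define D where "D n = \<Phi> n - (\<Sum>i<n. a i)" for n
  have inj: "inj \<sigma>" and pos: "1 \<le> \<sigma> i" for i using \<sigma> by (auto simp: decr_enum_def)
  have dec: "a n \<le> a m" if "m \<le> n" for m n using decr_enum_antimono[OF \<sigma> that] by (simp add: a_def)
  have a0: "0 \<le> a n" for n by (simp add: a_def)
  have D0: "D 0 = 0" by (simp add: D_def)
  have D_Suc: "D (Suc n) = D n + V n - a n" for n by (simp add: D_def \<Phi>_Suc)
  have D_nonneg: "0 \<le> D n" for n
  proof -
    have i: "inj_on \<sigma> {..<n}" using inj by (rule inj_on_subset) simp
    have "(\<Sum>k\<in>\<sigma> ` {..<n}. \<bar>x k\<bar>) \<le> \<Phi> (card (\<sigma> ` {..<n}))"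
      by (rule majorizedD[OF x]) (use pos in auto)
    then show ?thesis by (simp add: D_def a_def sum.reindex[OF i] card_image[OF i])
  qed
  have "\<exists>n. D (Suc n) > 0"
  proof (rule ccontr)
    assume "\<not> ?thesis"
    then have "D (Suc n) = 0" for n using D_nonneg[of "Suc n"] by (metis not_less order_antisym)
    then have "D n = 0" for n by (cases n) (simp_all add: D0)
    then show False using D_Suc[of n0] ne by (simp add: a_def)
  qed
  define p where "p = (LEAST n. D (Suc n) > 0)"
  have p: "D (Suc p) > 0" unfolding p_def by (rule LeastI_ex) fact
  have before: "D n = 0" if "n \<le> p" for n
  proof (cases n)
    case (Suc m)
    then have "\<not> D (Suc m) > 0" using that not_less_Least[of m "\<lambda>n. D (Suc n) > 0"] by (simp add: p_def)
    then show ?thesis using D_nonneg[of n] Suc by simp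
  qed (simp add: D0)
  have gap: "a p < a (p - 1)" if "0 < p"
  proof -
    have "a (p - 1) = V (p - 1)" using D_Suc[of "p - 1"] before[of p] before[of "p - 1"] that by simp
    moreover have "a p < V p" using D_Suc[of p] before[of p] p by simp
    moreover have "V p \<le> V (p - 1)" by (rule V_antimono) simp
    ultimately show ?thesis by simp
  qed
  have least: "\<exists>\<delta>>0. \<forall>t\<in>T. \<delta> \<le> t" if "finite T" "\<And>t. t \<in> T \<Longrightarrow> 0 < t" for T :: "real set"
    by (rule exI[of _ "Min (insert 1 T)"]) (use that in auto)
  show thesis
  proof (cases "\<exists>r. Suc p < r \<and> a r < a (r - 1) \<and> (\<forall>n. p < n \<longrightarrow> n < r \<longrightarrow> 0 < D n)")
    case True
    then obtain r where r: "Suc p < r" "a r < a (r - 1)" "\<And>n. p < n \<Longrightarrow> n < r \<Longrightarrow> 0 < D n" by blast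
    define T where "T = insert (a (r - 1) - a r) ((if 0 < p then {a (p - 1) - a p} else {}) \<union> D ` {p<..<r})"
    obtain \<delta> where \<delta>: "0 < \<delta>" "\<And>t. t \<in> T \<Longrightarrow> \<delta> \<le> t"
    proof -
      have "finite T" by (simp add: T_def)
      moreover have "0 < t" if "t \<in> T" for t
        using that gap r by (auto simp: T_def split: if_splits)
      ultimately show thesis using least[of T] that by blast
    qed
    have \<delta>1: "\<delta> \<le> a (r - 1) - a r" and \<delta>2: "0 < p \<Longrightarrow> \<delta> \<le> a (p - 1) - a p"
      and \<delta>3: "p < n \<Longrightarrow> n < r \<Longrightarrow> \<delta> \<le> D n" for n
      using \<delta>(2) by (auto simp: T_def)
    have mid: "(\<Sum>i<n. \<bar>x (\<sigma> i)\<bar>) + \<delta> \<le> \<Phi> n" if "p < n" "n < r" for n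
      using \<delta>3[OF that] by (simp add: D_def a_def)
    define k l where "k = \<sigma> p" and "l = \<sigma> (r - 1)"
    have kl: "k \<noteq> l" using r(1) by (simp add: k_def l_def inj_eq[OF inj])
    have xl: "\<delta> \<le> \<bar>x l\<bar>" using \<delta>1 a0[of r] by (simp add: l_def a_def)
    have xk: "\<delta> \<le> \<bar>x k\<bar>" 
    proof -
      have "a (r - 1) \<le> a p" by (rule dec) (use r(1) in simp)
      then show ?thesis using xl by (simp add: k_def l_def a_def)
    qed
    define d where "d i = (if i = k then \<delta> * sgn (x k) else if i = l then - \<delta> * sgn (x l) else 0)" for i
    show thesis
    proof (rule that[of "max k l" d k])
      show "majorized (\<lambda>i. x i + d i)"
      proof (rule majorized_transfer[OF x \<sigma>, where p = p and r = r and ?i1.0 = p and ?i2.0 = "r - 1" and \<delta> = \<delta>])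
        show "\<bar>x (\<sigma> p) + d (\<sigma> p)\<bar> = \<bar>x (\<sigma> p)\<bar> + \<delta>"
          using xk \<delta>(1) unfolding k_def[symmetric] by (auto simp: d_def sgn_real_def)
        show "\<bar>x (\<sigma> (r - 1)) + d (\<sigma> (r - 1))\<bar> = \<bar>x (\<sigma> (r - 1))\<bar> - \<delta>"
          using xl \<delta>(1) kl unfolding l_def[symmetric] by (auto simp: d_def sgn_real_def)
        show "\<bar>x i + d i\<bar> = \<bar>x i\<bar>" if "i \<noteq> \<sigma> p" "i \<noteq> \<sigma> (r - 1)" for i
          using that by (simp add: d_def k_def l_def)
      qed (use r \<delta>1 \<delta>2 \<delta>(1) mid in \<open>auto simp: a_def\<close>)
      show "majorized (\<lambda>i. x i - d i)"
      proof (rule majorized_transfer[OF x \<sigma>, where p = p and r = r and ?i1.0 = "r - 1" and ?i2.0 = p and \<delta> = \<delta>])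
        show "\<bar>x (\<sigma> p) - d (\<sigma> p)\<bar> = \<bar>x (\<sigma> p)\<bar> - \<delta>"
          using xk \<delta>(1) unfolding k_def[symmetric] by (auto simp: d_def sgn_real_def)
        show "\<bar>x (\<sigma> (r - 1)) - d (\<sigma> (r - 1))\<bar> = \<bar>x (\<sigma> (r - 1))\<bar> + \<delta>"
          using xl \<delta>(1) kl unfolding l_def[symmetric] by (auto simp: d_def sgn_real_def)
        show "\<bar>x i - d i\<bar> = \<bar>x i\<bar>" if "i \<noteq> \<sigma> (r - 1)" "i \<noteq> \<sigma> p" for i
          using that by (simp add: d_def k_def l_def)
      qed (use r \<delta>1 \<delta>2 \<delta>(1) mid in \<open>auto simp: a_def\<close>)
      show "d k \<noteq> 0" using xk \<delta>(1) by (auto simp: d_def sgn_real_def)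
      show "1 \<le> k" using pos by (simp add: k_def)
      show "d i = 0" if "max k l < i" for i using that by (auto simp: d_def)
    qed
  next
    case False
    have D_pos: "0 < D n" if "p < n" for n
    proof (rule ccontr)
      assume "\<not> 0 < D n"
      then have "\<exists>n. p < n \<and> D n = 0" using that D_nonneg[of n] by force
      define r where "r = (LEAST n. p < n \<and> D n = 0)"
      have r: "p < r" "D r = 0"
        using LeastI_ex[OF \<open>\<exists>n. p < n \<and> D n = 0\<close>] by (auto simp: r_def)
      have lt: "0 < D n" if "p < n" "n < r" for n
        using not_less_Least[of n "\<lambda>n. p < n \<and> D n = 0"] that D_nonneg[of n] by (auto simp: r_def)
      \<comment> \<open>The slack vanishes again at \<open>r\<close>, so \<open>\<bar>x \<circ> \<sigma>\<bar>\<close> exceeds \<open>V\<close> before \<open>r\<close> and not at \<open>r\<close>.\<close>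
      have r': "Suc p < r" using r p by (metis Suc_lessI less_irrefl)
      have "p < r - 1" "r - 1 < r" using r' by simp_all
      then have "V (r - 1) < a (r - 1)" using D_Suc[of "r - 1"] lt[of "r - 1"] r by simp
      moreover have "a r \<le> V r" using D_Suc[of r] r(2) D_nonneg[of "Suc r"] by simp
      moreover have "V r \<le> V (r - 1)" by (rule V_antimono) simp
      ultimately have "a r < a (r - 1)" by linarith
      then show False using False r' lt by blast
    qed
    have const: "a (Suc p + m) = a (Suc p)" for m
    proof (induction m)
      case (Suc m)
      have "\<not> a (Suc p + Suc m) < a (Suc p + Suc m - 1)"
        using False D_pos by (metis add_Suc_right less_add_Suc1)
      then show ?case using Suc dec[of "Suc p + m" "Suc p + Suc m"] by simp
    qed simp
    have az: "a (Suc p) = 0"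
    proof (rule ccontr)
      assume "a (Suc p) \<noteq> 0"
      then have "0 < a (Suc p)" using a0[of "Suc p"] by simp
      from majorized_finite_levels[OF x this]
      have "finite (\<sigma> ` range (\<lambda>m. Suc p + m))"
        by (rule rev_finite_subset) (use const pos in \<open>auto simp: a_def\<close>)
      moreover have "infinite (\<sigma> ` range (\<lambda>m. Suc p + m))"
        using inj by (subst finite_image_iff) (auto intro: inj_on_subset simp: finite_image_iff inj_on_def)
      ultimately show False by simp
    qed
    have grow: "D (Suc p) \<le> D (Suc p + m)" for m
    proof (induction m)
      case (Suc m)
      then show ?case using D_Suc[of "Suc p + m"] const[of m] az V_nonneg[of "Suc p + m"] by simp
    qed simp
    obtain \<delta> where \<delta>: "0 < \<delta>" "\<delta> \<le> D (Suc p)" "0 < p \<Longrightarrow> \<delta> \<le> a (p - 1) - a p"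
    proof -
      let ?T = "insert (D (Suc p)) (if 0 < p then {a (p - 1) - a p} else {})"
      have "finite ?T" by simp
      moreover have "0 < t" if "t \<in> ?T" for t
        using that gap p by (auto split: if_splits)
      ultimately obtain \<delta> where "0 < \<delta>" "\<And>t. t \<in> ?T \<Longrightarrow> \<delta> \<le> t" using least[of ?T] by blast
      then show thesis by (intro that) auto
    qed
    have mid: "(\<Sum>i<n. \<bar>x (\<sigma> i)\<bar>) + \<delta> \<le> \<Phi> n" if n: "p < n" for n
    proof -
      obtain m where m: "n = Suc p + m" using less_imp_Suc_add[OF n] by auto
      have "\<delta> \<le> D n" using grow[of m] \<delta>(2) unfolding m by (rule order_trans[rotated])
      then show ?thesis by (simp add: D_def a_def)
    qed
    define d where "d i = (if i = \<sigma> p then \<delta> else 0)" for i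
    show thesis
    proof (rule that[of "\<sigma> p" d "\<sigma> p"])
      show "majorized (\<lambda>i. x i + d i)"
        by (rule majorized_bump[OF x \<sigma>, of p \<delta>]) (use \<delta>(1,3) mid in \<open>simp_all add: d_def a_def\<close>)
      show "majorized (\<lambda>i. x i - d i)"
        by (rule majorized_bump[OF x \<sigma>, of p \<delta>]) (use \<delta>(1,3) mid in \<open>simp_all add: d_def a_def\<close>)
    qed (use \<delta> pos in \<open>auto simp: d_def\<close>)
  qed
qed

end

section \<open>The characterization\<close>

theorem theorem6p6:
  fixes w \<psi> x :: "nat \<Rightarrow> real" and f :: "(nat \<Rightarrow> real) \<Rightarrow> real"
  assumes "nonneg_weight w"
    and "\<And>n. n \<ge> 1 \<Longrightarrow> \<psi> n = real n / fund_seq w n"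
    and "f \<in> dual_sphere w"
    and "represents w x f"
  shows "dual_ball_extreme w f \<longleftrightarrow>
    (\<forall>n\<ge>1. rearr x n = ennreal (\<Sum>i. w (n + i) / real (n + i)))"
proof -
  interpret lorentz_weight w by unfold_locales (fact assms(1))
  note f = assms(3,4)
  have x: "majorized x"
    using coord_majorized[of f] f by (simp add: represents_coord dual_sphere_def)
  obtain \<sigma> where \<sigma>: "decr_enum x \<sigma>"
    using exists_decr_enum[OF majorized_finite_levels[OF x]] by blast
  have V: "(\<Sum>i. w (Suc n + i) / real (Suc n + i)) = V n" for n
    by (simp add: V_def q_def)
  have "(\<forall>n\<ge>1. rearr x n = ennreal (\<Sum>i. w (n + i) / real (n + i))) \<longleftrightarrow>
      (\<forall>n. rearr x (Suc n) = ennreal (V n))"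
    unfolding V[symmetric] by (metis One_nat_def Suc_le_D le_add1 plus_1_eq_Suc)
  also have "\<dots> \<longleftrightarrow> (\<forall>n. \<bar>x (\<sigma> n)\<bar> = V n)"
    by (simp add: rearr_decr_enum[OF \<sigma>] V_nonneg)
  also have "\<dots> \<longleftrightarrow> dual_ball_extreme w f"
  proof
    assume "\<forall>n. \<bar>x (\<sigma> n)\<bar> = V n"
    then show "dual_ball_extreme w f" using extreme_if_enum_eq[OF f \<sigma>] by blast
  next
    assume ex: "dual_ball_extreme w f"
    show "\<forall>n. \<bar>x (\<sigma> n)\<bar> = V n"
    proof (rule ccontr)
      assume "\<not> ?thesis"
      then obtain n where n: "\<bar>x (\<sigma> n)\<bar> \<noteq> V n" by blast
      show False
        by (rule exists_perturbation[OF x \<sigma> n], rule notE[OF not_extreme_if_perturbation[OF f] ex])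
    qed
  qed
  finally show ?thesis by blast
qed

end
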